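(* Let $G$ be a connected graph satisfying $\mathrm{CD}(2,\infty)$, and let $\Delta=\max_x\deg(x)$ be the maximum degree of $G$. If $\lambda_{\Delta-1}=2$, then $G\cong H_\Delta$.
   Context: All graphs are simple, finite, connected and unweighted. For $f:V(G)\to\mathbb{R}$ put $Lf(x)=\sum_{y\sim x}(f(y)-f(x))$. The eigenvalues of $-L$ are $0=\lambda_0<\lambda_1\le\lambda_2\le\cdots\le\lambda_{|V(G)|-1}$, counted with multiplicity (indexing starts at $0$). The Bakry--Émery operators are $2\Gamma(f,g)=L(fg)-fLg-gLf$ and $2\Gamma_2(f,g)=L\Gamma(f,g)-\Gamma(f,Lg)-\Gamma(g,Lf)$, with $\Gamma(f)=\Gamma(f,f)$ and $\Gamma_2(f)=\Gamma_2(f,f)$. $G$ satisfies $\mathrm{CD}(K,\infty)$ if $\Gamma_2(f)(x)\ge K\,\Gamma(f)(x)$ for all $f:V(G)\to\mathbb{R}$ and all $x\in V(G)$. $H_r$ is the $r$-dimensional hypercube: vertex set $\mathbb{F}_2^r$, two vertices adjacent iff they differ in exactly one coordinate. *)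

theory Defs
  imports
    Complex_Main
    "HOL-Library.Function_Algebras"
    "HOL-Library.FuncSet"
    "HOL-Library.Multiset"
    "HOL-Library.Z2"
    "Graph_Theory.Graph_Theory"
begin

text \<open>
  A finite simple graph is a record \<open>G :: 'a pair_pre_digraph\<close> satisfying \<^locale>\<open>pair_graph\<close>:
  a finite vertex set \<open>pverts G\<close> together with a symmetric, irreflexive set of arcs \<open>parcs G\<close>,
  each edge being represented by its two opposite arcs.  Functions on the vertex set are
  represented by functions \<open>'a \<Rightarrow> real\<close>; at vertices, none of the operators below depends on
  values outside \<open>pverts G\<close>.
\<close>

definition max_degree :: "'a pair_pre_digraph \<Rightarrow> nat" where
  "max_degree G = Max (out_degree (with_proj G) ` pverts G)"

definition laplacian :: "'a pair_pre_digraph \<Rightarrow> ('a \<Rightarrow> real) \<Rightarrow> 'a \<Rightarrow> real" where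
  "laplacian G f x = (\<Sum>y | (x, y) \<in> parcs G. f y - f x)"


subsection \<open>Bakry--Emery curvature\<close>

definition BE_Gamma :: "'a pair_pre_digraph \<Rightarrow> ('a \<Rightarrow> real) \<Rightarrow> ('a \<Rightarrow> real) \<Rightarrow> 'a \<Rightarrow> real" where
  "BE_Gamma G f g x =
     (laplacian G (\<lambda>y. f y * g y) x - f x * laplacian G g x - g x * laplacian G f x) / 2"

definition BE_Gamma2 :: "'a pair_pre_digraph \<Rightarrow> ('a \<Rightarrow> real) \<Rightarrow> ('a \<Rightarrow> real) \<Rightarrow> 'a \<Rightarrow> real" where
  "BE_Gamma2 G f g x =
     (laplacian G (BE_Gamma G f g) x - BE_Gamma G f (laplacian G g) x - BE_Gamma G g (laplacian G f) x) / 2"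

definition CD_infinity :: "real \<Rightarrow> 'a pair_pre_digraph \<Rightarrow> bool" where
  "CD_infinity K G \<longleftrightarrow>
     (\<forall>f :: 'a \<Rightarrow> real. \<forall>x \<in> pverts G. BE_Gamma2 G f f x \<ge> K * BE_Gamma G f f x)"


subsection \<open>Laplacian eigenvalues\<close>

text \<open>
  Requiring eigenfunctions to vanish outside the vertex set identifies the eigenspace with a
  subspace of the space of real functions on \<open>pverts G\<close>.
\<close>

definition laplacian_eigenspace :: "'a pair_pre_digraph \<Rightarrow> real \<Rightarrow> ('a \<Rightarrow> real) set" where
  "laplacian_eigenspace G \<mu> =
     {f. (\<forall>x \<in> pverts G. - laplacian G f x = \<mu> * f x) \<and> (\<forall>x. x \<notin> pverts G \<longrightarrow> f x = 0)}"

definition laplacian_spectrum :: "'a pair_pre_digraph \<Rightarrow> real set" where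
  "laplacian_spectrum G = {\<mu>. \<exists>f \<in> laplacian_eigenspace G \<mu>. f \<noteq> 0}"

text \<open>
  The negated Laplacian is self-adjoint, so there is no difference between algebraic and geometric
  multiplicity.
\<close>

definition laplacian_multiplicity :: "'a pair_pre_digraph \<Rightarrow> real \<Rightarrow> nat" where
  "laplacian_multiplicity G \<mu> =
     vector_space.dim (\<lambda>(c :: real) (f :: 'a \<Rightarrow> real) x. c * f x) (laplacian_eigenspace G \<mu>)"

definition laplacian_eigenvalues :: "'a pair_pre_digraph \<Rightarrow> real multiset" where
  "laplacian_eigenvalues G = (\<Sum>\<mu> \<in> laplacian_spectrum G. replicate_mset (laplacian_multiplicity G \<mu>) \<mu>)"

text \<open>The \<open>k\<close>-th smallest eigenvalue, counted with multiplicity and starting at \<open>k = 0\<close>.\<close>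

definition laplacian_eigenvalue :: "'a pair_pre_digraph \<Rightarrow> nat \<Rightarrow> real" where
  "laplacian_eigenvalue G k = sorted_list_of_multiset (laplacian_eigenvalues G) ! k"


subsection \<open>The hypercube\<close>

text \<open>Vectors over the two-element field are extensional functions on \<open>{..<r}\<close>.\<close>

definition hypercube :: "nat \<Rightarrow> (nat \<Rightarrow> bit) pair_pre_digraph" where
  "hypercube r =
     \<lparr> pverts = {..<r} \<rightarrow>\<^sub>E (UNIV :: bit set),
       parcs = {(u, v). u \<in> {..<r} \<rightarrow>\<^sub>E UNIV \<and> v \<in> {..<r} \<rightarrow>\<^sub>E UNIV \<and>
                        card {i. i < r \<and> u i \<noteq> v i} = 1} \<rparr>"

end

theory Submission
  imports Defs "HOL-Computational_Algebra.Fundamental_Theorem_Algebra"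
begin

text \<open>
  Write \<open>L\<close> for the Laplacian and let \<open>f\<close> be an eigenfunction, \<open>L f = -2 f\<close>.  The curvature bound gives
  \<open>L (\<Gamma> f) \<ge> 0\<close>, and on a finite connected graph a subharmonic function is constant.  Hence \<open>\<Gamma> f\<close> is
  constant and \<open>\<Gamma>\<^sub>2 f = 2 \<Gamma> f\<close> at every vertex.  As \<open>\<Gamma>\<^sub>2 - 2 \<Gamma>\<close> is positive semidefinite, \<open>f\<close> lies in its
  kernel, so that the polarised equation holds against all test functions.  Delta functions as test
  functions yield two linear identities for \<open>f\<close>: one for each edge (\<open>E2_edge\<close>) and one for each pair of
  vertices at distance two (\<open>E2_distance_two\<close>).

  Below \<open>2\<close> the only eigenvalue is \<open>0\<close>, and it is simple.  So the hypothesis, together with the fact that the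
  Laplacian of a graph with \<open>N\<close> vertices has \<open>N\<close> eigenvalues, provides \<open>m = \<Delta> - 1\<close> independent eigenfunctions
  for \<open>2\<close>.  Orthonormalised with respect to \<open>\<Gamma>\<close>, which is the same inner product at all vertices, they
  form a map \<open>p\<close> from the vertices to \<open>\<real>\<^sup>m\<close>.  The differences of \<open>p\<close> along the edges at \<open>x\<close> have the Gram matrix
  \<open>I - n n\<^sup>T\<close>, where \<open>n\<close> is a unit vector or zero: at most one dimension is missing.  The edge identity
  becomes a linear relation among these edge vectors, hence a multiple of \<open>n\<close>; comparison of the relations of
  neighbouring edges shows that the graph is regular and has no triangles.  The identity at distance two
  expresses the normal vector at a neighbour of \<open>x\<close> by that at \<open>x\<close>.  The resulting quadratic equations
  leave only the codegrees 1, 2 and 4 for vertices at distance two.  Codegree 1 would continue to an infinite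
  geodesic on which \<open>p\<close> is affine, and codegree 4 would create two neighbours of one vertex whose edge vectors
  have an impossible inner product.  So any two edges at a vertex span exactly one square (\<open>common_two\<close>), and
  \<open>p\<close> maps it to a parallelogram.

  It remains to go from local to global.  Three edges at a vertex span a cube (\<open>cube\<close>), since a failure
  would contradict the Gram matrix at one of the corners.  Therefore the transport of edge labels across squares
  defines commuting involutions on labelled vertices, and their orbit is a covering of the graph by the
  hypercube.  Two sets of labels that lead to the same vertex give a relation among the edge vectors, that is, a
  multiple of \<open>n\<close>; one further step along an edge shows that the sets are equal (\<open>vertex_at_inj\<close>).
  The covering is an isomorphism.
\<close>

section \<open>Laplacian, Dirichlet form and connectedness\<close>

definition nbrs :: "'a pair_pre_digraph \<Rightarrow> 'a \<Rightarrow> 'a set" where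
  "nbrs G x = {y. (x, y) \<in> parcs G}"

lemma laplacian_nbrs: "laplacian G f x = (\<Sum>y\<in>nbrs G x. f y - f x)"
  by (simp add: laplacian_def nbrs_def)

context pair_graph
begin

lemma nbrs_sym: "y \<in> nbrs G x \<longleftrightarrow> x \<in> nbrs G y"
  using arcs_symmetric by (auto simp: nbrs_def)

lemma nbrs_irrefl: "x \<notin> nbrs G x"
  using no_loops by (force simp: nbrs_def)

lemma nbrs_verts: "nbrs G x \<subseteq> pverts G"
  by (auto simp: nbrs_def dest: in_arcsD2)

lemma finite_nbrs: "finite (nbrs G x)"
  using nbrs_verts pair_finite_verts finite_subset by blast

lemma degree_nbrs: "out_degree (with_proj G) x = card (nbrs G x)"
proof -
  have "out_arcs (with_proj G) x = Pair x ` nbrs G x"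
    by (auto simp: out_arcs_def nbrs_def)
  then show ?thesis
    by (simp add: out_degree_def card_image inj_on_def)
qed

lemma card_nbrs_le_max_degree: "x \<in> pverts G \<Longrightarrow> card (nbrs G x) \<le> max_degree G"
  unfolding max_degree_def degree_nbrs[symmetric]
  by (simp add: pair_finite_verts)

lemma max_degree_attained:
  assumes "pverts G \<noteq> {}"
  obtains x where "x \<in> pverts G" "card (nbrs G x) = max_degree G"
proof -
  have "max_degree G \<in> out_degree (with_proj G) ` pverts G"
    unfolding max_degree_def using assms pair_finite_verts by (intro Max_in) auto
  then show ?thesis using that by (auto simp: degree_nbrs)
qed

lemma connected_nonempty: "Digraph_Component.connected (with_proj G) \<Longrightarrow> pverts G \<noteq> {}"
  by (simp add: connected_def strongly_connected_def mk_symmetric_def)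

text \<open>
  The arc set is symmetric, so the symmetric closure that defines connectedness adds nothing.
\<close>
lemma connected_induct:
  assumes "Digraph_Component.connected (with_proj G)"
    and "x \<in> pverts G" "P x" "y \<in> pverts G"
    and step: "\<And>u v. u \<in> pverts G \<Longrightarrow> v \<in> nbrs G u \<Longrightarrow> P u \<Longrightarrow> P v"
  shows "P y"
proof -
  have "x \<rightarrow>\<^sup>*\<^bsub>with_proj (mk_symmetric (with_proj G))\<^esub> y"
    using assms by (simp add: connected_def strongly_connected_def mk_symmetric_def)
  then have "(x, y) \<in> rtrancl_on (pverts G) (parcs (mk_symmetric (with_proj G)))"
    by (simp add: reachable_def mk_symmetric_def)
  moreover have "parcs (mk_symmetric (with_proj G)) = parcs G"
    using arcs_symmetric by (auto simp: mk_symmetric_def)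
  ultimately have "(x, y) \<in> rtrancl_on (pverts G) (parcs G)" by simp
  then show ?thesis
    by (induction rule: rtrancl_on_induct) (auto intro: step \<open>P x\<close> simp: nbrs_def)
qed

lemma sum_nbrs_swap:
  "(\<Sum>x\<in>pverts G. \<Sum>y\<in>nbrs G x. F x y) = (\<Sum>x\<in>pverts G. \<Sum>y\<in>nbrs G x. F y x)"
proof -
  have *: "(\<Sum>y\<in>nbrs G x. H y) = (\<Sum>y\<in>pverts G. if y \<in> nbrs G x then H y else 0)" for x and H :: "'a \<Rightarrow> 'b"
    using nbrs_verts[of x] pair_finite_verts
    by (simp add: sum.If_cases Int_absorb1 inf_commute)
  show ?thesis
    unfolding * by (subst sum.swap) (simp add: nbrs_sym cong: if_cong)
qed

text \<open>
  Summation by parts: exchange the two ends of every arc and average.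
\<close>
lemma sum_laplacian_eq_Dirichlet:
  "(\<Sum>x\<in>pverts G. f x * laplacian G g x)
     = - (\<Sum>x\<in>pverts G. \<Sum>y\<in>nbrs G x. (f y - f x) * (g y - g x)) / 2"
proof -
  let ?S = "\<lambda>F. \<Sum>x\<in>pverts G. \<Sum>y\<in>nbrs G x. (F x y :: real)"
  have "?S (\<lambda>x y. f x * (g y - g x)) = ?S (\<lambda>x y. f y * (g x - g y))"
    by (rule sum_nbrs_swap)
  moreover have "?S (\<lambda>x y. (f y - f x) * (g y - g x))
      = - ?S (\<lambda>x y. f y * (g x - g y)) - ?S (\<lambda>x y. f x * (g y - g x))"
    by (simp add: sum_negf[symmetric] sum_subtractf[symmetric] algebra_simps)
  ultimately show ?thesis
    unfolding laplacian_nbrs sum_distrib_left by linarith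
qed

lemma laplacian_self_adjoint:
  "(\<Sum>x\<in>pverts G. f x * laplacian G g x) = (\<Sum>x\<in>pverts G. g x * laplacian G f x)"
  by (simp add: sum_laplacian_eq_Dirichlet mult.commute)

lemma sum_laplacian: "(\<Sum>x\<in>pverts G. laplacian G f x) = 0"
  using sum_laplacian_eq_Dirichlet[of "\<lambda>_. 1" f] by simp

lemma const_if_edge_const:
  assumes "Digraph_Component.connected (with_proj G)"
    and "\<And>x y. x \<in> pverts G \<Longrightarrow> y \<in> nbrs G x \<Longrightarrow> f y = f x"
    and "x \<in> pverts G" "y \<in> pverts G"
  shows "f x = f y"
  by (rule connected_induct[where P = "\<lambda>v. f x = f v", OF assms(1,3) _ assms(4)]) (simp_all add: assms(2))

text \<open>
  A harmonic function has Dirichlet energy zero.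
\<close>
lemma harmonic_const:
  assumes conn: "Digraph_Component.connected (with_proj G)"
    and harm: "\<And>x. x \<in> pverts G \<Longrightarrow> laplacian G f x = 0"
    and "x \<in> pverts G" "y \<in> pverts G"
  shows "f x = f y"
proof (rule const_if_edge_const[OF conn _ assms(3,4)])
  have "(\<Sum>x\<in>pverts G. \<Sum>y\<in>nbrs G x. (f y - f x) * (f y - f x)) = 0"
    using sum_laplacian_eq_Dirichlet[of f f] harm by simp
  then have "\<forall>x\<in>pverts G. (\<Sum>y\<in>nbrs G x. (f y - f x) * (f y - f x)) = 0"
    by (subst (asm) sum_nonneg_eq_0_iff) (auto intro: sum_nonneg pair_finite_verts)
  then show "f y = f x" if "x \<in> pverts G" "y \<in> nbrs G x" for x y
    using that finite_nbrs by (auto simp: sum_nonneg_eq_0_iff)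
qed

text \<open>
  The Laplacian of any function has mean zero, so subharmonic functions are harmonic.
\<close>
lemma subharmonic_const:
  assumes conn: "Digraph_Component.connected (with_proj G)"
    and sub: "\<And>x. x \<in> pverts G \<Longrightarrow> laplacian G f x \<ge> 0"
    and "x \<in> pverts G" "y \<in> pverts G"
  shows "f x = f y"
proof (rule harmonic_const[OF conn _ assms(3,4)])
  show "laplacian G f x = 0" if "x \<in> pverts G" for x
    using sum_laplacian[of f] sub that pair_finite_verts by (simp add: sum_nonneg_eq_0_iff)
qed

end

section \<open>Bakry--Emery calculus\<close>

context pair_graph
begin

lemma BE_Gamma_nbrs: "BE_Gamma G f g x = (\<Sum>y\<in>nbrs G x. (f y - f x) * (g y - g x)) / 2"
  by (simp add: BE_Gamma_def laplacian_nbrs sum_distrib_left sum_subtractf[symmetric] algebra_simps)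

lemma BE_Gamma_commute: "BE_Gamma G f g = BE_Gamma G g f"
  by (simp add: fun_eq_iff BE_Gamma_nbrs mult.commute)

lemma laplacian_scale_add:
  "laplacian G (\<lambda>y. f y + t * g y) x = laplacian G f x + t * laplacian G g x"
  by (simp add: laplacian_nbrs sum_distrib_left sum.distrib[symmetric] algebra_simps)

lemma BE_Gamma_scale_add_right:
  "BE_Gamma G h (\<lambda>y. f y + t * g y) x = BE_Gamma G h f x + t * BE_Gamma G h g x"
  by (simp add: BE_Gamma_nbrs sum_distrib_left sum.distrib[symmetric] add_divide_distrib[symmetric] algebra_simps)

lemma BE_Gamma_scale_add_left:
  "BE_Gamma G (\<lambda>y. f y + t * g y) h x = BE_Gamma G f h x + t * BE_Gamma G g h x"
  by (simp add: BE_Gamma_commute[of _ h] BE_Gamma_scale_add_right)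

lemma BE_Gamma2_commute: "BE_Gamma2 G f g = BE_Gamma2 G g f"
  by (simp add: fun_eq_iff BE_Gamma2_def BE_Gamma_commute[of f g])

lemma BE_Gamma2_scale_add_right:
  "BE_Gamma2 G h (\<lambda>y. f y + t * g y) x = BE_Gamma2 G h f x + t * BE_Gamma2 G h g x"
proof -
  have "laplacian G (BE_Gamma G h (\<lambda>y. f y + t * g y)) x
      = laplacian G (BE_Gamma G h f) x + t * laplacian G (BE_Gamma G h g) x"
    by (simp add: laplacian_scale_add[symmetric] BE_Gamma_scale_add_right[abs_def])
  moreover have "BE_Gamma G h (laplacian G (\<lambda>y. f y + t * g y)) x
      = BE_Gamma G h (laplacian G f) x + t * BE_Gamma G h (laplacian G g) x"
    by (simp add: BE_Gamma_scale_add_right[symmetric] laplacian_scale_add[abs_def])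
  ultimately show ?thesis
    by (simp add: BE_Gamma2_def BE_Gamma_scale_add_left algebra_simps diff_divide_distrib add_divide_distrib)
qed

lemma BE_Gamma2_scale_add_left:
  "BE_Gamma2 G (\<lambda>y. f y + t * g y) h x = BE_Gamma2 G f h x + t * BE_Gamma2 G g h x"
  by (simp add: BE_Gamma2_commute[of _ h] BE_Gamma2_scale_add_right)

text \<open>
  A null vector of a positive semidefinite form belongs to its kernel.  Here the form is
  \<open>\<Gamma>\<^sub>2 - K \<Gamma>\<close> at \<open>x\<close>; along \<open>f + t g\<close> it equals \<open>2 t b + t\<^sup>2 c\<close>, which takes negative values unless \<open>b = 0\<close>.
\<close>
lemma CD_equality_kernel:
  assumes CD: "CD_infinity K G" and x: "x \<in> pverts G"
    and eq: "BE_Gamma2 G f f x = K * BE_Gamma G f f x"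
  shows "BE_Gamma2 G f g x = K * BE_Gamma G f g x"
proof (rule ccontr)
  define b where "b = BE_Gamma2 G f g x - K * BE_Gamma G f g x"
  define c where "c = BE_Gamma2 G g g x - K * BE_Gamma G g g x"
  assume "BE_Gamma2 G f g x \<noteq> K * BE_Gamma G f g x"
  then have "b \<noteq> 0" by (simp add: b_def)
  have nonneg: "0 \<le> 2 * t * b + t * t * c" for t
  proof -
    let ?h = "\<lambda>y. f y + t * g y"
    have "0 \<le> BE_Gamma2 G ?h ?h x - K * BE_Gamma G ?h ?h x"
      using CD x by (simp add: CD_infinity_def)
    also have "\<dots> = 2 * t * b + t * t * c"
      using eq
      by (simp add: b_def c_def BE_Gamma2_scale_add_right BE_Gamma2_scale_add_left
          BE_Gamma_scale_add_right BE_Gamma_scale_add_left BE_Gamma2_commute[of g f]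
          BE_Gamma_commute[of g f] algebra_simps)
    finally show ?thesis .
  qed
  have "c \<ge> 0" using CD x by (simp add: CD_infinity_def c_def)
  \<comment> \<open>close to the minimum of the quadratic polynomial; the summand 1 covers the case \<open>c = 0\<close>\<close>
  define t where "t = - b / (c + 1)"
  have "t * (c + 1) = - b" using \<open>c \<ge> 0\<close> by (simp add: t_def)
  then have "t * c = - b - t" by (simp add: algebra_simps)
  then have "2 * t * b + t * t * c = t * b - t * t"
    by (simp only: mult.assoc) (simp add: algebra_simps)
  also have "t * b = - (b * b) / (c + 1)" by (simp add: t_def)
  also have "- (b * b) / (c + 1) - t * t < 0"
  proof -
    have "b * b / (c + 1) > 0" using \<open>b \<noteq> 0\<close> \<open>c \<ge> 0\<close> by (auto simp: zero_less_mult_iff neq_iff)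
    moreover have "t * t \<ge> 0" by simp
    ultimately show ?thesis unfolding minus_divide_left[symmetric] by linarith
  qed
  finally show False using nonneg[of t] by simp
qed

lemma BE_Gamma_eigenfunction:
  assumes "\<And>y. y \<in> pverts G \<Longrightarrow> laplacian G f y = - \<theta> * f y" and "x \<in> pverts G"
  shows "BE_Gamma G g (laplacian G f) x = - \<theta> * BE_Gamma G g f x"
proof -
  have "laplacian G f y = - \<theta> * f y" if "y \<in> nbrs G x" for y
    using assms(1) nbrs_verts that by blast
  then show ?thesis
    using assms(1)[OF assms(2)]
    by (simp add: BE_Gamma_nbrs sum_distrib_left sum_negf[symmetric] algebra_simps)
qed

text \<open>
  Bochner's formula for an eigenfunction.
\<close>
lemma laplacian_Gamma_eigenfunction:
  assumes "\<And>y. y \<in> pverts G \<Longrightarrow> laplacian G f y = - \<theta> * f y" and "x \<in> pverts G"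
  shows "2 * BE_Gamma2 G f f x = laplacian G (BE_Gamma G f f) x + 2 * \<theta> * BE_Gamma G f f x"
  by (simp add: BE_Gamma2_def BE_Gamma_eigenfunction[OF assms] field_simps)

lemma Gamma_zero_imp_const:
  assumes conn: "Digraph_Component.connected (with_proj G)"
    and zero: "\<And>x. x \<in> pverts G \<Longrightarrow> BE_Gamma G f f x = 0"
    and "x \<in> pverts G" "y \<in> pverts G"
  shows "f x = f y"
proof (rule const_if_edge_const[OF conn _ assms(3,4)])
  fix x y assume "x \<in> pverts G" "y \<in> nbrs G x"
  then show "f y = f x"
    using zero[of x] finite_nbrs[of x] by (simp add: BE_Gamma_nbrs sum_nonneg_eq_0_iff)
qed

text \<open>
  The Lichnerowicz estimate.  Summed over all vertices, the Laplacian in Bochner's formula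
  disappears and leaves \<open>(K - \<theta>) \<Sum> \<Gamma> f \<le> 0\<close>; so \<open>f\<close> has no gradient.
\<close>
lemma eigenfunction_const_if_less:
  assumes conn: "Digraph_Component.connected (with_proj G)"
    and CD: "CD_infinity K G" and "\<theta> < K"
    and eig: "\<And>y. y \<in> pverts G \<Longrightarrow> laplacian G f y = - \<theta> * f y"
    and "x \<in> pverts G" "y \<in> pverts G"
  shows "f x = f y"
proof (rule Gamma_zero_imp_const[OF conn _ assms(5,6)])
  have nonneg: "BE_Gamma G f f x \<ge> 0" for x by (simp add: BE_Gamma_nbrs sum_nonneg)
  have "laplacian G (BE_Gamma G f f) x \<ge> 2 * (K - \<theta>) * BE_Gamma G f f x" if "x \<in> pverts G" for x
  proof -
    have "BE_Gamma2 G f f x \<ge> K * BE_Gamma G f f x"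
      using CD that by (simp add: CD_infinity_def)
    then show ?thesis
      using laplacian_Gamma_eigenfunction[of f \<theta>, OF eig that] by (simp add: algebra_simps)
  qed
  then have "(\<Sum>x\<in>pverts G. 2 * (K - \<theta>) * BE_Gamma G f f x) \<le> 0"
    using sum_mono[of "pverts G"] sum_laplacian[of "BE_Gamma G f f"] by metis
  then have "(K - \<theta>) * (\<Sum>x\<in>pverts G. BE_Gamma G f f x) \<le> 0"
    unfolding sum_distrib_left[symmetric] mult.assoc by linarith
  then have "(\<Sum>x\<in>pverts G. BE_Gamma G f f x) \<le> 0"
    using \<open>\<theta> < K\<close> by (simp add: mult_le_0_iff)
  then have "(\<Sum>x\<in>pverts G. BE_Gamma G f f x) = 0"
    using nonneg by (meson antisym sum_nonneg)
  then show "BE_Gamma G f f x = 0" if "x \<in> pverts G" for x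
    using nonneg that pair_finite_verts by (simp add: sum_nonneg_eq_0_iff)
qed

end

section \<open>Eigenfunctions attaining the curvature bound\<close>

locale curvature_two_graph = pair_graph +
  assumes conn: "Digraph_Component.connected (with_proj G)"
    and CD2: "CD_infinity 2 G"
begin

definition E2 :: "('a \<Rightarrow> real) set" where "E2 = laplacian_eigenspace G 2"

lemma E2D: "f \<in> E2 \<Longrightarrow> x \<in> pverts G \<Longrightarrow> laplacian G f x = - 2 * f x"
  by (force simp: E2_def laplacian_eigenspace_def)

lemma E2_add: "f \<in> E2 \<Longrightarrow> g \<in> E2 \<Longrightarrow> (\<lambda>x. f x + t * g x) \<in> E2"
  unfolding E2_def laplacian_eigenspace_def mem_Collect_eq laplacian_scale_add minus_add_distrib
  by (simp add: minus_mult_right algebra_simps del: mult_minus_right)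

text \<open>
  At the extremal eigenvalue, Bochner's formula and the curvature bound leave
  \<open>L (\<Gamma> f) \<ge> 0\<close>.
\<close>
lemma E2_Gamma_diag_const:
  assumes "f \<in> E2" "x \<in> pverts G" "y \<in> pverts G"
  shows "BE_Gamma G f f x = BE_Gamma G f f y"
proof (rule subharmonic_const[OF conn _ assms(2,3)])
  fix x assume x: "x \<in> pverts G"
  then have "BE_Gamma2 G f f x \<ge> 2 * BE_Gamma G f f x"
    using CD2 by (simp add: CD_infinity_def)
  then show "laplacian G (BE_Gamma G f f) x \<ge> 0"
    using laplacian_Gamma_eigenfunction[of f 2, OF E2D[OF assms(1)] x] by simp
qed

lemma E2_Gamma_const:
  assumes "f \<in> E2" "g \<in> E2" "x \<in> pverts G" "y \<in> pverts G"
  shows "BE_Gamma G f g x = BE_Gamma G f g y"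
proof -
  have "BE_Gamma G (\<lambda>z. f z + 1 * g z) (\<lambda>z. f z + 1 * g z) x = BE_Gamma G (\<lambda>z. f z + 1 * g z) (\<lambda>z. f z + 1 * g z) y"
    using E2_Gamma_diag_const[OF E2_add[OF assms(1,2)] assms(3,4)] .
  then show ?thesis
    using E2_Gamma_diag_const[OF assms(1,3,4)] E2_Gamma_diag_const[OF assms(2,3,4)]
    unfolding BE_Gamma_scale_add_right BE_Gamma_scale_add_left BE_Gamma_commute[of g f] by simp
qed

text \<open>
  Since \<open>\<Gamma> f\<close> is constant, \<open>f\<close> attains the curvature bound at every vertex, and
  \<open>CD_equality_kernel\<close> makes the equality linear in an arbitrary test function \<open>g\<close>.  The next
  lemmas evaluate it for delta functions.
\<close>
lemma E2_equality:
  assumes f: "f \<in> E2" and x: "x \<in> pverts G"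
  shows "laplacian G (BE_Gamma G f g) x - BE_Gamma G f (laplacian G g) x = 2 * BE_Gamma G f g x"
proof -
  have nx: "BE_Gamma G f f y = BE_Gamma G f f x" if "y \<in> nbrs G x" for y
    using E2_Gamma_diag_const[OF f] that nbrs_verts x by blast
  have "laplacian G (BE_Gamma G f f) x = 0"
    by (simp add: laplacian_nbrs nx)
  then have "BE_Gamma2 G f f x = 2 * BE_Gamma G f f x"
    using laplacian_Gamma_eigenfunction[of f 2, OF E2D[OF f] x] by simp
  then have "BE_Gamma2 G f g x = 2 * BE_Gamma G f g x"
    using CD_equality_kernel[OF CD2 x] by blast
  moreover have "BE_Gamma G g (laplacian G f) x = - 2 * BE_Gamma G g f x"
    using BE_Gamma_eigenfunction[of f 2, OF E2D[OF f] x] by simp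
  ultimately show ?thesis
    by (simp add: BE_Gamma2_def BE_Gamma_commute[of g f] field_simps)
qed

lemma Gamma_delta:
  assumes "w \<noteq> z"
  shows "BE_Gamma G f (\<lambda>v. if v = z then 1 else 0) w = (if z \<in> nbrs G w then (f z - f w) / 2 else 0)"
proof -
  have "(\<Sum>y\<in>nbrs G w. (f y - f w) * ((if y = z then 1 else 0) - (if w = z then 1 else 0)))
      = (\<Sum>y\<in>nbrs G w. if y = z then f y - f w else 0)"
    using assms by (intro sum.cong) auto
  then show ?thesis by (simp add: BE_Gamma_nbrs finite_nbrs)
qed

lemma laplacian_delta:
  assumes "w \<noteq> z"
  shows "laplacian G (\<lambda>v. if v = z then 1 else 0) w = (if z \<in> nbrs G w then 1 else 0)"
proof -
  have "(\<Sum>y\<in>nbrs G w. (if y = z then 1 else 0) - (if w = z then 1 else 0))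
      = (\<Sum>y\<in>nbrs G w. if y = z then 1 else (0::real))"
    using assms by (intro sum.cong) auto
  then show ?thesis by (simp add: laplacian_nbrs finite_nbrs)
qed

lemma sum_nbrs_if_nbr:
  "(\<Sum>y\<in>nbrs G x. if z \<in> nbrs G y then F y else 0) = (\<Sum>y\<in>nbrs G x \<inter> nbrs G z. F y)"
proof -
  have "nbrs G x \<inter> {y. z \<in> nbrs G y} = nbrs G x \<inter> nbrs G z" using nbrs_sym by blast
  then show ?thesis by (simp add: sum.If_cases finite_nbrs)
qed

text \<open>
  The test function is the delta function at \<open>z\<close>: over the common neighbours, the mean of \<open>f\<close>
  is the midpoint of \<open>f x\<close> and \<open>f z\<close>.
\<close>
lemma E2_distance_two:
  fixes f :: "'a \<Rightarrow> real"
  assumes f: "f \<in> E2" and x: "x \<in> pverts G" and z: "z \<notin> nbrs G x" "z \<noteq> x"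
  shows "card (nbrs G x \<inter> nbrs G z) * (f z + f x) = 2 * (\<Sum>y\<in>nbrs G x \<inter> nbrs G z. f y)"
proof -
  let ?g = "\<lambda>v. if v = z then 1 else (0::real)"
  have Gx: "BE_Gamma G f ?g x = 0" using z by (simp add: Gamma_delta)
  have ne: "y \<noteq> z" if "y \<in> nbrs G x" for y using that z by blast
  have "laplacian G (BE_Gamma G f ?g) x
      = (\<Sum>y\<in>nbrs G x. if z \<in> nbrs G y then (f z - f y) / 2 else 0)"
    unfolding laplacian_nbrs Gx by (intro sum.cong) (simp_all add: Gamma_delta ne)
  moreover have "BE_Gamma G f (laplacian G ?g) x
      = (\<Sum>y\<in>nbrs G x. if z \<in> nbrs G y then (f y - f x) / 2 else 0)"
    unfolding BE_Gamma_nbrs sum_divide_distrib using z by (intro sum.cong) (simp_all add: laplacian_delta ne)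
  ultimately have "(\<Sum>y\<in>nbrs G x \<inter> nbrs G z. (f z - f y) / 2 - (f y - f x) / 2) = 0"
    using E2_equality[OF f x, of ?g] Gx by (simp add: sum_nbrs_if_nbr sum_subtractf)
  then have "2 * (\<Sum>y\<in>nbrs G x \<inter> nbrs G z. (f z - f y) / 2 - (f y - f x) / 2) = 0" by simp
  then have "(\<Sum>y\<in>nbrs G x \<inter> nbrs G z. (f z + f x) - 2 * f y) = 0"
    unfolding sum_distrib_left by (simp add: algebra_simps diff_divide_distrib)
  then show ?thesis by (simp add: sum_subtractf sum_distrib_left)
qed

text \<open>
  The test function is the delta function at the neighbour \<open>y\<close>.  The sum measures triangles on
  the edge, the other term measures irregularity.
\<close>
lemma E2_edge:
  fixes f :: "'a \<Rightarrow> real"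
  assumes f: "f \<in> E2" and x: "x \<in> pverts G" and y: "y \<in> nbrs G x"
  shows "(\<Sum>w\<in>nbrs G x \<inter> nbrs G y. f y + f x - 2 * f w)
    + (real (card (nbrs G y)) - real (card (nbrs G x))) * (f y - f x) = 0"
proof -
  let ?g = "\<lambda>v. if v = y then 1 else (0::real)"
  let ?C = "nbrs G x \<inter> nbrs G y"
  have yx: "y \<noteq> x" "y \<in> pverts G" "y \<notin> nbrs G y" using y nbrs_irrefl nbrs_verts by auto
  have split: "(\<Sum>w\<in>nbrs G x. F w) = F y + (\<Sum>w\<in>nbrs G x - {y}. F w)" for F :: "'a \<Rightarrow> real"
    using y finite_nbrs by (simp add: sum.remove)
  have C: "(\<Sum>w\<in>nbrs G x - {y}. if y \<in> nbrs G w then F w else 0) = sum F ?C" for F :: "'a \<Rightarrow> real"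
  proof -
    have "(nbrs G x - {y}) \<inter> {w. y \<in> nbrs G w} = ?C" using nbrs_sym yx by blast
    then show ?thesis by (simp add: sum.If_cases finite_nbrs)
  qed
  have Gx: "BE_Gamma G f ?g x = (f y - f x) / 2" using y yx by (simp add: Gamma_delta)
  have Gy: "BE_Gamma G f ?g y = f y"
  proof -
    have "(\<Sum>u\<in>nbrs G y. (f u - f y) * (?g u - ?g y)) = (\<Sum>u\<in>nbrs G y. - (f u - f y))"
      using yx by (intro sum.cong) auto
    also have "\<dots> = - laplacian G f y" by (simp add: laplacian_nbrs sum_negf[symmetric])
    finally show ?thesis using E2D[OF f yx(2)] by (simp add: BE_Gamma_nbrs)
  qed
  have "(\<Sum>w\<in>nbrs G x - {y}. BE_Gamma G f ?g w) = (\<Sum>w\<in>nbrs G x - {y}. if y \<in> nbrs G w then (f y - f w) / 2 else 0)"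
    by (intro sum.cong) (auto simp: Gamma_delta)
  then have 1: "laplacian G (BE_Gamma G f ?g) x
      = f y + (\<Sum>w\<in>?C. (f y - f w) / 2) - card (nbrs G x) * ((f y - f x) / 2)"
    unfolding laplacian_nbrs sum_subtractf split[of "BE_Gamma G f ?g"] Gx Gy by (simp add: C)
  have Lx: "laplacian G ?g x = 1" using y yx by (simp add: laplacian_delta)
  have Ly: "laplacian G ?g y = - card (nbrs G y)"
  proof -
    have "(\<Sum>u\<in>nbrs G y. ?g u - ?g y) = (\<Sum>u\<in>nbrs G y. - 1)"
      using yx by (intro sum.cong) auto
    then show ?thesis by (simp add: laplacian_nbrs)
  qed
  have "(\<Sum>w\<in>nbrs G x - {y}. (f w - f x) * laplacian G ?g w)
      = (\<Sum>w\<in>nbrs G x - {y}. if y \<in> nbrs G w then f w - f x else 0)"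
    by (intro sum.cong) (auto simp: laplacian_delta)
  then have "(\<Sum>w\<in>nbrs G x. (f w - f x) * laplacian G ?g w)
      = (f y - f x) * (- card (nbrs G y)) + (\<Sum>w\<in>?C. f w - f x)"
    unfolding split[of "\<lambda>w. (f w - f x) * laplacian G ?g w"] Ly by (simp add: C)
  moreover have "2 * BE_Gamma G f (laplacian G ?g) x
      = (\<Sum>w\<in>nbrs G x. (f w - f x) * laplacian G ?g w) - laplacian G f x"
    by (simp add: BE_Gamma_nbrs Lx laplacian_nbrs[of G f x] sum_subtractf[symmetric] algebra_simps)
  ultimately have 2: "2 * BE_Gamma G f (laplacian G ?g) x
      = (f y - f x) * (- card (nbrs G y)) + (\<Sum>w\<in>?C. f w - f x) + 2 * f x"
    using E2D[OF f x] by simp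
  have 3: "(\<Sum>w\<in>?C. f y + f x - 2 * f w) = 2 * (\<Sum>w\<in>?C. (f y - f w) / 2) - (\<Sum>w\<in>?C. f w - f x)"
    by (simp add: sum_distrib_left sum_subtractf[symmetric] diff_divide_distrib algebra_simps)
  show ?thesis
    using E2_equality[OF f x, of ?g] 1 2 unfolding 3 Gx by (simp add: algebra_simps diff_divide_distrib)
qed

lemma E2_add_sum:
  fixes k :: nat
  assumes "g \<in> E2" "\<And>i. i < k \<Longrightarrow> fs i \<in> E2"
  shows "(\<lambda>x. g x + (\<Sum>i<k. c i * fs i x)) \<in> E2"
  using assms(2)
proof (induction k)
  case (Suc k)
  then show ?case using E2_add[of "\<lambda>x. g x + (\<Sum>i<k. c i * fs i x)" "fs k" "c k"] by (simp add: add.assoc)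
qed (simp add: assms(1))

lemma Gamma_add_sum:
  fixes k :: nat
  shows "BE_Gamma G (\<lambda>x. g x + (\<Sum>i<k. c i * fs i x)) h x
     = BE_Gamma G g h x + (\<Sum>i<k. c i * BE_Gamma G (fs i) h x)"
proof (induction k)
  case (Suc k)
  then show ?case
    using BE_Gamma_scale_add_left[of "\<lambda>x. g x + (\<Sum>i<k. c i * fs i x)" "c k" "fs k" h x]
    by (simp add: add.assoc)
qed simp

text \<open>
  If \<open>\<Gamma> f\<close> vanishes at one vertex, it vanishes everywhere; then \<open>f\<close> is constant, and the
  eigenvalue equation makes it zero.
\<close>
lemma E2_Gamma_pos:
  assumes f: "f \<in> E2" "f \<noteq> 0" and x: "x \<in> pverts G"
  shows "BE_Gamma G f f x > 0"
proof (rule ccontr)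
  assume neg: "\<not> ?thesis"
  moreover have "BE_Gamma G f f x \<ge> 0" by (simp add: BE_Gamma_nbrs sum_nonneg)
  ultimately have zero: "BE_Gamma G f f y = 0" if "y \<in> pverts G" for y
    using E2_Gamma_diag_const[OF f(1) x that] by simp
  have "f y = 0" for y
  proof (cases "y \<in> pverts G")
    case True
    have "f z = f y" if "z \<in> nbrs G y" for z
      using Gamma_zero_imp_const[OF conn zero] that nbrs_verts True by blast
    then have "laplacian G f y = 0" by (simp add: laplacian_nbrs)
    then show ?thesis using E2D[OF f(1) True] by simp
  qed (use f in \<open>auto simp: E2_def laplacian_eigenspace_def\<close>)
  then show False using f(2) by (simp add: fun_eq_iff)
qed

end

interpretation fun_space: vector_space "\<lambda>(c :: real) (f :: 'a \<Rightarrow> real) x. c * f x"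
  by unfold_locales (auto simp: fun_eq_iff algebra_simps)

lemma sum_fun_apply: "(\<Sum>i\<in>A. F i) x = (\<Sum>i\<in>A. F i x)"
  by (induction A rule: infinite_finite_induct) simp_all

context curvature_two_graph
begin

text \<open>
  Gram--Schmidt for the inner product \<open>2 \<Gamma>\<close> at one vertex.  By \<open>E2_Gamma_const\<close> the family is then
  orthonormal at all vertices at once.
\<close>
lemma E2_orthonormal_family:
  assumes x: "x \<in> pverts G" and "k \<le> laplacian_multiplicity G 2"
  shows "\<exists>fs. (\<forall>i<k. fs i \<in> E2) \<and> (\<forall>i<k. \<forall>j<k. 2 * BE_Gamma G (fs i) (fs j) x = (if i = j then 1 else 0))"
  using assms(2)
proof (induction k)
  case (Suc k)
  then obtain fs where fs: "\<And>i. i < k \<Longrightarrow> fs i \<in> E2"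
    and on: "\<And>i j. i < k \<Longrightarrow> j < k \<Longrightarrow> 2 * BE_Gamma G (fs i) (fs j) x = (if i = j then 1 else 0)"
    by auto
  have "\<not> E2 \<subseteq> fun_space.span (fs ` {..<k})"
  proof
    assume "E2 \<subseteq> fun_space.span (fs ` {..<k})"
    then have "fun_space.dim E2 \<le> card (fs ` {..<k})" by (rule fun_space.dim_le_card) simp
    also have "\<dots> \<le> k" using card_image_le[of "{..<k}" fs] by simp
    finally show False using Suc.prems by (simp add: laplacian_multiplicity_def E2_def)
  qed
  then obtain g where g: "g \<in> E2" "g \<notin> fun_space.span (fs ` {..<k})" by blast
  define c where "c i = - 2 * BE_Gamma G g (fs i) x" for i
  define h where "h = (\<lambda>x. g x + (\<Sum>i<k. c i * fs i x))"
  have h: "h \<in> E2" unfolding h_def by (rule E2_add_sum[OF g(1) fs])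
  have "h \<noteq> 0"
  proof
    assume "h = 0"
    then have "g = (\<Sum>i<k. (\<lambda>x. - c i * fs i x))"
      by (auto simp: h_def fun_eq_iff sum_fun_apply sum_negf eq_neg_iff_add_eq_0)
    also have "\<dots> \<in> fun_space.span (fs ` {..<k})"
      by (intro fun_space.span_sum fun_space.span_scale fun_space.span_base) auto
    finally show False using g(2) by blast
  qed
  have orth: "BE_Gamma G h (fs j) x = 0" if "j < k" for j
  proof -
    have "(\<Sum>i<k. c i * BE_Gamma G (fs i) (fs j) x) = (\<Sum>i<k. if i = j then c j / 2 else 0)"
    proof (intro sum.cong refl)
      fix i assume "i \<in> {..<k}"
      then show "c i * BE_Gamma G (fs i) (fs j) x = (if i = j then c j / 2 else 0)"
        using on[of i j] that by (auto split: if_splits)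
    qed
    then have "(\<Sum>i<k. c i * BE_Gamma G (fs i) (fs j) x) = c j / 2" using that by simp
    moreover have "BE_Gamma G h (fs j) x = BE_Gamma G g (fs j) x + (\<Sum>i<k. c i * BE_Gamma G (fs i) (fs j) x)"
      unfolding h_def by (rule Gamma_add_sum)
    ultimately show ?thesis by (simp add: c_def)
  qed
  define r where "r = sqrt (2 * BE_Gamma G h h x)"
  have r: "r > 0" "r * r = 2 * BE_Gamma G h h x" using E2_Gamma_pos[OF h \<open>h \<noteq> 0\<close> x] by (simp_all add: r_def)
  define h' where "h' = (\<lambda>y. 0 y + (1 / r) * h y)"
  have "0 \<in> E2" by (simp add: E2_def laplacian_eigenspace_def laplacian_nbrs)
  then have h': "h' \<in> E2" unfolding h'_def by (rule E2_add[OF _ h])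
  have Gh': "BE_Gamma G h' f y = (1 / r) * BE_Gamma G h f y" for f y
    by (simp add: h'_def BE_Gamma_nbrs sum_divide_distrib diff_divide_distrib[symmetric] mult.commute[of r])
  have "2 * BE_Gamma G h' h' x = 1"
  proof -
    have "BE_Gamma G h' h' x = (1 / r) * ((1 / r) * BE_Gamma G h h x)"
      unfolding Gh' BE_Gamma_commute[of h h'] Gh' ..
    then have "2 * BE_Gamma G h' h' x = (1 / r) * (1 / r) * (r * r)" using r(2) by simp
    then show ?thesis using r(1) by simp
  qed
  moreover have "BE_Gamma G h' (fs j) x = 0" "BE_Gamma G (fs j) h' x = 0" if "j < k" for j
    using orth[OF that] BE_Gamma_commute[of "fs j" h'] by (simp_all add: Gh')
  ultimately have "\<forall>i<Suc k. \<forall>j<Suc k. 2 * BE_Gamma G ((fs(k := h')) i) ((fs(k := h')) j) x = (if i = j then 1 else 0)"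
    using on by (auto simp: less_Suc_eq)
  moreover have "\<forall>i<Suc k. (fs(k := h')) i \<in> E2" using fs h' by (auto simp: less_Suc_eq)
  ultimately show ?case by blast
qed simp

end

section \<open>Spectral decomposition of the Laplacian\<close>

context pair_graph
begin

definition vertex_functions :: "('a \<Rightarrow> real) set" where
  "vertex_functions = {f. \<forall>x. x \<notin> pverts G \<longrightarrow> f x = 0}"

definition vertex_inner :: "('a \<Rightarrow> real) \<Rightarrow> ('a \<Rightarrow> real) \<Rightarrow> real" where
  "vertex_inner f g = (\<Sum>x\<in>pverts G. f x * g x)"

definition vertex_laplacian :: "('a \<Rightarrow> real) \<Rightarrow> 'a \<Rightarrow> real" where
  "vertex_laplacian f x = (if x \<in> pverts G then laplacian G f x else 0)"

lemma vertex_inner_commute: "vertex_inner f g = vertex_inner g f"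
  by (simp add: vertex_inner_def mult.commute)

lemma vertex_laplacian_self_adjoint: "vertex_inner (vertex_laplacian f) g = vertex_inner f (vertex_laplacian g)"
proof -
  have "vertex_inner (vertex_laplacian f) g = (\<Sum>x\<in>pverts G. g x * laplacian G f x)"
    unfolding vertex_inner_def by (intro sum.cong) (auto simp: vertex_laplacian_def)
  also have "\<dots> = (\<Sum>x\<in>pverts G. f x * laplacian G g x)" by (rule laplacian_self_adjoint)
  also have "\<dots> = vertex_inner f (vertex_laplacian g)"
    unfolding vertex_inner_def by (intro sum.cong) (auto simp: vertex_laplacian_def)
  finally show ?thesis .
qed

lemma vertex_inner_pos:
  assumes "f \<in> vertex_functions" "f \<noteq> 0"
  shows "vertex_inner f f > 0"
proof -
  obtain x where "f x \<noteq> 0" using assms(2) by (auto simp: fun_eq_iff)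
  moreover from this have "x \<in> pverts G" using assms(1) unfolding vertex_functions_def by blast
  ultimately show ?thesis
    unfolding vertex_inner_def by (intro sum_pos2[OF pair_finite_verts, of x]) (auto simp: zero_less_mult_iff)
qed

lemma vertex_inner_sum_left: "vertex_inner (\<lambda>x. \<Sum>b\<in>B. c b * F b x) g = (\<Sum>b\<in>B. c b * vertex_inner (F b) g)"
  unfolding vertex_inner_def sum_distrib_left sum_distrib_right
  by (subst sum.swap) (simp add: mult.assoc)

lemma eigenspace_iff:
  "f \<in> laplacian_eigenspace G \<theta> \<longleftrightarrow> f \<in> vertex_functions \<and> vertex_laplacian f = (\<lambda>x. - \<theta> * f x)"
proof
  assume f: "f \<in> laplacian_eigenspace G \<theta>"
  have "vertex_laplacian f x = - \<theta> * f x" for x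
  proof (cases "x \<in> pverts G")
    case True
    then have "- laplacian G f x = \<theta> * f x" using f unfolding laplacian_eigenspace_def by blast
    then show ?thesis using True unfolding vertex_laplacian_def by simp
  next
    case False
    then have "f x = 0" using f unfolding laplacian_eigenspace_def by blast
    then show ?thesis using False by (simp add: vertex_laplacian_def)
  qed
  moreover have "f \<in> vertex_functions" using f unfolding laplacian_eigenspace_def vertex_functions_def by blast
  ultimately show "f \<in> vertex_functions \<and> vertex_laplacian f = (\<lambda>x. - \<theta> * f x)" by blast
next
  assume f: "f \<in> vertex_functions \<and> vertex_laplacian f = (\<lambda>x. - \<theta> * f x)"
  have "- laplacian G f x = \<theta> * f x" if "x \<in> pverts G" for x
  proof -
    have "vertex_laplacian f x = - \<theta> * f x" using f by (simp only:)
    then show ?thesis using that unfolding vertex_laplacian_def by simp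
  qed
  then show "f \<in> laplacian_eigenspace G \<theta>"
    using f unfolding laplacian_eigenspace_def vertex_functions_def by blast
qed

lemma vertex_inner_eigenfunction:
  assumes "f \<in> laplacian_eigenspace G \<theta>"
  shows "vertex_inner (vertex_laplacian f) g = - \<theta> * vertex_inner f g"
proof -
  have "vertex_laplacian f = (\<lambda>x. - \<theta> * f x)" using assms by (simp only: eigenspace_iff)
  then have "vertex_inner (vertex_laplacian f) g = (\<Sum>x\<in>pverts G. (- \<theta> * f x) * g x)" by (simp only: vertex_inner_def)
  then show ?thesis unfolding vertex_inner_def sum_distrib_left by (simp only: mult.assoc)
qed

lemma eigenspaces_orthogonal:
  assumes "f \<in> laplacian_eigenspace G \<theta>" "g \<in> laplacian_eigenspace G \<eta>" "\<theta> \<noteq> \<eta>"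
  shows "vertex_inner f g = 0"
proof -
  have "- \<theta> * vertex_inner f g = - \<eta> * vertex_inner f g"
    using vertex_laplacian_self_adjoint[of f g] vertex_inner_eigenfunction[OF assms(1), of g] vertex_inner_eigenfunction[OF assms(2), of f]
      vertex_inner_commute[of g f] vertex_inner_commute[of "vertex_laplacian g" f] by simp
  then show ?thesis using assms(3) by simp
qed

lemma orthogonal_independent:
  assumes B: "finite B" "B \<subseteq> vertex_functions" "0 \<notin> B"
    and orth: "\<And>f g. f \<in> B \<Longrightarrow> g \<in> B \<Longrightarrow> f \<noteq> g \<Longrightarrow> vertex_inner f g = 0"
  shows "\<not> fun_space.dependent B"
proof (rule fun_space.independent_if_scalars_zero[OF B(1)])
  fix c g assume zero: "(\<Sum>b\<in>B. (\<lambda>x. c b * b x)) = 0" and g: "g \<in> B"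
  have "(\<lambda>x. \<Sum>b\<in>B. c b * b x) = 0" using zero by (simp add: fun_eq_iff sum_fun_apply)
  then have "0 = vertex_inner (\<lambda>x. \<Sum>b\<in>B. c b * b x) g" by (simp add: vertex_inner_def)
  also have "\<dots> = (\<Sum>b\<in>B. c b * vertex_inner b g)" by (rule vertex_inner_sum_left)
  also have "\<dots> = (\<Sum>b\<in>B. if b = g then c g * vertex_inner g g else 0)"
    using orth[OF _ g] by (intro sum.cong) auto
  also have "\<dots> = c g * vertex_inner g g" using B(1) g by simp
  finally have "c g * vertex_inner g g = 0" by simp
  moreover have "g \<noteq> 0" using B(3) g by metis
  then have "vertex_inner g g > 0" using vertex_inner_pos B(2) g by blast
  ultimately show "c g = 0" by simp
qed

definition delta :: "'a \<Rightarrow> 'a \<Rightarrow> real" where "delta v = (\<lambda>x. if x = v then 1 else 0)"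

lemma vertex_functions_span: "vertex_functions \<subseteq> fun_space.span (delta ` pverts G)"
proof
  fix f assume f: "f \<in> vertex_functions"
  have "f = (\<Sum>v\<in>pverts G. (\<lambda>x. f v * delta v x))"
  proof
    fix x
    have "(\<Sum>v\<in>pverts G. f v * delta v x) = (\<Sum>v\<in>pverts G. if v = x then f x else 0)"
      by (intro sum.cong) (auto simp: delta_def)
    then show "f x = (\<Sum>v\<in>pverts G. (\<lambda>x. f v * delta v x)) x"
      using f pair_finite_verts by (simp add: sum_fun_apply vertex_functions_def)
  qed
  also have "\<dots> \<in> fun_space.span (delta ` pverts G)"
    by (intro fun_space.span_sum fun_space.span_scale fun_space.span_base) auto
  finally show "f \<in> fun_space.span (delta ` pverts G)" .
qed

lemma card_delta: "card (delta ` pverts G) = card (pverts G)"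
proof (intro card_image inj_onI)
  fix v w assume "delta v = delta w"
  then have "delta v v = delta w v" by (rule fun_cong)
  then show "v = w" by (simp add: delta_def split: if_splits)
qed

lemma independent_card_le:
  assumes "\<not> fun_space.dependent B" "B \<subseteq> vertex_functions"
  shows "finite B" "card B \<le> card (pverts G)"
proof -
  have "finite B \<and> card B \<le> card (delta ` pverts G)"
    by (rule fun_space.independent_span_bound[OF _ assms(1)])
      (use assms(2) vertex_functions_span pair_finite_verts in auto)
  then show "finite B" "card B \<le> card (pverts G)" by (simp_all add: card_delta)
qed

lemma card_vertices_le_spanning:
  assumes "finite B" "vertex_functions \<subseteq> fun_space.span B"
  shows "card (pverts G) \<le> card B"
proof -
  have sub: "delta ` pverts G \<subseteq> vertex_functions" by (auto simp: vertex_functions_def delta_def)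
  have "\<not> fun_space.dependent (delta ` pverts G)"
  proof (rule orthogonal_independent[OF _ sub])
    have "0 \<noteq> delta v" for v
    proof
      assume "0 = delta v"
      then have "0 v = delta v v" by (rule fun_cong)
      then show False by (simp add: delta_def)
    qed
    then show "0 \<notin> delta ` pverts G" by blast
    show "vertex_inner f g = 0" if "f \<in> delta ` pverts G" "g \<in> delta ` pverts G" "f \<noteq> g" for f g
      using that by (auto simp: vertex_inner_def delta_def intro!: sum.neutral)
  qed (simp add: pair_finite_verts)
  then have "card (delta ` pverts G) \<le> card B"
    using fun_space.independent_span_bound[OF assms(1)] sub assms(2) by blast
  then show ?thesis by (simp add: card_delta)
qed

text \<open>
  The dimension of an eigenspace is the size of a basis, and an independent set extends to one.
\<close>
lemma card_le_multiplicity: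
  assumes "B \<subseteq> laplacian_eigenspace G \<theta>" "\<not> fun_space.dependent B"
  shows "card B \<le> laplacian_multiplicity G \<theta>"
proof -
  obtain B' where B': "B \<subseteq> B'" "B' \<subseteq> laplacian_eigenspace G \<theta>" "\<not> fun_space.dependent B'"
    "laplacian_eigenspace G \<theta> \<subseteq> fun_space.span B'"
    using fun_space.maximal_independent_subset_extend[OF assms] by blast
  have "B' \<subseteq> vertex_functions" using B'(2) by (auto simp: eigenspace_iff)
  then have "finite B'" by (rule independent_card_le(1)[OF B'(3)])
  then have "card B \<le> card B'" using B'(1) by (rule card_mono)
  also have "\<dots> = laplacian_multiplicity G \<theta>"
    unfolding laplacian_multiplicity_def by (rule fun_space.basis_card_eq_dim[OF B'(2,4,3)])
  finally show ?thesis .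
qed

lemma vertex_laplacian_sum: "vertex_laplacian (\<lambda>x. \<Sum>i\<in>I. c i * F i x) = (\<lambda>x. \<Sum>i\<in>I. c i * vertex_laplacian (F i) x)"
proof
  fix x
  have "laplacian G (\<lambda>x. \<Sum>i\<in>I. c i * F i x) x = (\<Sum>i\<in>I. c i * laplacian G (F i) x)"
    unfolding laplacian_nbrs sum_subtractf[symmetric] sum_distrib_left
    by (subst sum.swap) (simp add: right_diff_distrib)
  then show "vertex_laplacian (\<lambda>x. \<Sum>i\<in>I. c i * F i x) x = (\<Sum>i\<in>I. c i * vertex_laplacian (F i) x)"
    by (simp add: vertex_laplacian_def)
qed

text \<open>
  There are more terms than the dimension \<open>card (pverts G)\<close>.  A repeated term is also a relation,
  but it does not show up as a dependence of the set of terms.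
\<close>
lemma sequence_relation:
  assumes K: "\<And>i. K i \<in> vertex_functions"
  obtains c :: "nat \<Rightarrow> real" and N j where "j \<le> N" "c j \<noteq> 0" "\<And>x. (\<Sum>i\<le>N. c i * K i x) = 0"
proof (cases "inj_on K {..card (pverts G)}")
  case True
  let ?S = "K ` {..card (pverts G)}"
  have "card ?S = Suc (card (pverts G))" using True by (simp add: card_image)
  moreover have "?S \<subseteq> vertex_functions" using K by blast
  ultimately have "fun_space.dependent ?S" using independent_card_le(2)[of ?S] by force
  then obtain u where u: "\<exists>v\<in>?S. u v \<noteq> 0" "(\<Sum>v\<in>?S. (\<lambda>x. u v * v x)) = 0"
    using fun_space.dependent_finite[of ?S] by auto
  then obtain j where j: "j \<le> card (pverts G)" "u (K j) \<noteq> 0" by auto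
  have "(\<Sum>i\<le>card (pverts G). u (K i) * K i x) = 0" for x
  proof -
    have "(\<Sum>i\<le>card (pverts G). u (K i) * K i x) = (\<Sum>v\<in>?S. u v * v x)"
      by (simp add: sum.reindex[OF True])
    also have "\<dots> = (\<Sum>v\<in>?S. (\<lambda>x. u v * v x)) x" by (simp add: sum_fun_apply)
    also have "\<dots> = 0" by (simp add: u(2))
    finally show ?thesis .
  qed
  then show ?thesis using that[of j "card (pverts G)" "\<lambda>i. u (K i)"] j by blast
next
  case False
  then obtain i j where ij: "i \<noteq> j" "K i = K j" by (auto simp: inj_on_def)
  define c where "c k = (if k = i then 1 else if k = j then - 1 else (0::real))" for k
  have "(\<Sum>k\<le>max i j. c k * K k x) = 0" for x
  proof -
    have "(\<Sum>k\<le>max i j. c k * K k x) = (\<Sum>k\<in>{i, j}. c k * K k x)"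
      by (rule sum.mono_neutral_right) (auto simp: c_def)
    then show ?thesis using ij by (simp add: c_def)
  qed
  then show ?thesis using that[of i "max i j" c] by (simp add: c_def)
qed

text \<open>
  A Krylov argument.  Among the complex polynomials that annihilate \<open>w\<close>, when applied to the Laplacian,
  take one of least degree and split off a root \<open>z\<close>.  The cofactor maps \<open>w\<close> to some \<open>u \<noteq> 0\<close>
  with eigenvalue \<open>z\<close>.  Self-adjointness makes \<open>z\<close> real, so the real and the imaginary part of
  \<open>u\<close> are eigenfunctions unless they vanish.
\<close>
lemma invariant_subspace_eigenfunction:
  assumes U: "U \<subseteq> vertex_functions" and comb: "\<And>(c :: nat \<Rightarrow> real) F n. (\<And>i. F i \<in> U) \<Longrightarrow> (\<lambda>x. \<Sum>i\<le>n. c i * F i x) \<in> U"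
    and inv: "\<And>f. f \<in> U \<Longrightarrow> vertex_laplacian f \<in> U" and w: "w \<in> U" "w \<noteq> 0"
  shows "\<exists>f \<theta>. f \<in> U \<and> f \<noteq> 0 \<and> f \<in> laplacian_eigenspace G \<theta>"
proof -
  define K where "K i = (vertex_laplacian ^^ i) w" for i
  have KU: "K i \<in> U" for i by (induction i) (simp_all add: K_def w inv)
  have Kv: "K i \<in> vertex_functions" for i using KU U by blast
  have K_Suc: "vertex_laplacian (K i) = K (Suc i)" for i by (simp add: K_def)
  \<comment> \<open>\<open>A q\<close> is the polynomial \<open>q\<close> of the Laplacian, applied to \<open>w\<close>\<close>
  define A where "A q x = (\<Sum>i\<le>degree q. coeff q i * complex_of_real (K i x))" for q x
  have A_eq: "A q x = (\<Sum>i\<le>n. coeff q i * of_real (K i x))" if "degree q \<le> n" for q n x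
    unfolding A_def by (rule sum.mono_neutral_left) (use that in \<open>auto simp: coeff_eq_0\<close>)
  define P where "P q \<longleftrightarrow> q \<noteq> 0 \<and> (\<forall>x. A q x = 0)" for q
  obtain c N j where c: "j \<le> N" "c j \<noteq> 0" "\<And>x. (\<Sum>i\<le>N. c i * K i x) = 0"
    by (rule sequence_relation[of K, OF Kv]) blast
  have "\<exists>q. P q"
  proof
    let ?q = "\<Sum>i\<le>N. monom (complex_of_real (c i)) i"
    have co: "coeff ?q i = (if i \<le> N then of_real (c i) else 0)" for i
      by (simp add: coeff_sum)
    have "degree ?q \<le> N" by (rule degree_le) (simp add: co)
    then have "A ?q x = of_real (\<Sum>i\<le>N. c i * K i x)" for x
      by (simp add: A_eq co)
    moreover have "coeff ?q j \<noteq> 0" using c by (simp add: co)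
    ultimately show "P ?q" unfolding P_def by (metis c(3) coeff_0 of_real_0)
  qed
  then obtain q where q: "P q" and min: "\<And>r. P r \<Longrightarrow> degree q \<le> degree r"
    using ex_has_least_nat[of P _ degree] by blast
  have "degree q \<noteq> 0"
  proof
    assume "degree q = 0"
    then obtain a where a: "q = [:a:]" by (metis degree_eq_zeroE)
    then have "a \<noteq> 0" and "a * of_real (w x) = 0" for x
      using q by (auto simp: P_def A_def K_def)
    then show False using w(2) by (simp add: fun_eq_iff)
  qed
  then have "\<not> constant (poly q)" by (simp add: constant_degree)
  then obtain z where z: "poly q z = 0" using fundamental_theorem_of_algebra by blast
  then obtain r where r: "q = [:- z, 1:] * r" by (auto simp: poly_eq_0_iff_dvd)
  have "r \<noteq> 0" using q r by (auto simp: P_def)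
  then have "degree q = Suc (degree r)" unfolding r by (subst degree_mult_eq) auto
  then have "\<not> P r" using min[of r] by linarith
  define u where "u = A r"
  have "\<exists>x. u x \<noteq> 0" using \<open>\<not> P r\<close> \<open>r \<noteq> 0\<close> by (simp add: P_def u_def)
  have shift: "(\<Sum>i\<le>degree r. coeff r i * of_real (K (Suc i) x)) = z * u x" for x
  proof -
    have "0 = A q x" using q by (simp add: P_def)
    also have "\<dots> = (\<Sum>i\<le>Suc (degree r). coeff q i * of_real (K i x))"
      by (rule A_eq) (simp add: \<open>degree q = Suc (degree r)\<close>)
    also have "\<dots> = (\<Sum>i\<le>Suc (degree r). coeff (pCons 0 r) i * of_real (K i x))
        - z * (\<Sum>i\<le>Suc (degree r). coeff r i * of_real (K i x))"
      unfolding r by (simp add: sum_subtractf sum_distrib_left algebra_simps del: sum.atMost_Suc)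
    also have "(\<Sum>i\<le>Suc (degree r). coeff (pCons 0 r) i * of_real (K i x))
        = (\<Sum>i\<le>degree r. coeff r i * of_real (K (Suc i) x))"
      by (subst sum.atMost_Suc_shift) simp
    also have "(\<Sum>i\<le>Suc (degree r). coeff r i * of_real (K i x)) = u x"
      unfolding u_def by (rule A_eq[symmetric]) simp
    finally show ?thesis by simp
  qed
  define f where "f x = Re (u x)" for x
  define g where "g x = Im (u x)" for x
  have f_eq: "f = (\<lambda>x. \<Sum>i\<le>degree r. Re (coeff r i) * K i x)"
    and g_eq: "g = (\<lambda>x. \<Sum>i\<le>degree r. Im (coeff r i) * K i x)"
    by (simp_all add: f_def g_def u_def A_def fun_eq_iff)
  have fU: "f \<in> U" and gU: "g \<in> U" unfolding f_eq g_eq by (intro comb KU)+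
  have Lf: "vertex_laplacian f = (\<lambda>x. Re z * f x - Im z * g x)"
  proof
    fix x
    have "vertex_laplacian f x = Re (\<Sum>i\<le>degree r. coeff r i * of_real (K (Suc i) x))"
      unfolding f_eq vertex_laplacian_sum by (simp add: K_Suc)
    then show "vertex_laplacian f x = Re z * f x - Im z * g x" by (simp add: shift f_def g_def)
  qed
  have Lg: "vertex_laplacian g = (\<lambda>x. Re z * g x + Im z * f x)"
  proof
    fix x
    have "vertex_laplacian g x = Im (\<Sum>i\<le>degree r. coeff r i * of_real (K (Suc i) x))"
      unfolding g_eq vertex_laplacian_sum by (simp add: K_Suc)
    then show "vertex_laplacian g x = Re z * g x + Im z * f x" by (simp add: shift f_def g_def)
  qed
  have fg0: "f \<noteq> 0 \<or> g \<noteq> 0"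
    using \<open>\<exists>x. u x \<noteq> 0\<close> by (auto simp: fun_eq_iff f_def g_def complex_eq_iff)
  have "vertex_inner (vertex_laplacian f) g = Re z * vertex_inner f g - Im z * vertex_inner g g"
    by (simp add: Lf vertex_inner_def sum_distrib_left sum_subtractf[symmetric] algebra_simps)
  moreover have "vertex_inner f (vertex_laplacian g) = Re z * vertex_inner f g + Im z * vertex_inner f f"
    by (simp add: Lg vertex_inner_def sum_distrib_left sum.distrib[symmetric] algebra_simps)
  ultimately have "Im z * (vertex_inner f f + vertex_inner g g) = 0"
    using vertex_laplacian_self_adjoint[of f g] by (simp add: algebra_simps)
  moreover have "vertex_inner f f + vertex_inner g g > 0"
  proof -
    have "vertex_inner h h \<ge> 0" for h by (simp add: vertex_inner_def sum_nonneg)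
    then show ?thesis using fg0 vertex_inner_pos[of f] vertex_inner_pos[of g] fU gU U
      by (meson add_nonneg_pos add_pos_nonneg subsetD)
  qed
  ultimately have "Im z = 0" by simp
  then have "f \<in> laplacian_eigenspace G (- Re z)" "g \<in> laplacian_eigenspace G (- Re z)"
    using fU gU U by (auto simp: eigenspace_iff Lf Lg)
  then show ?thesis using fU gU fg0 by blast
qed

text \<open>An orthogonal family of eigenfunctions, possibly for different eigenvalues.\<close>
definition eigenfamily :: "('a \<Rightarrow> real) set \<Rightarrow> bool" where
  "eigenfamily B \<longleftrightarrow> finite B \<and> 0 \<notin> B \<and> (\<forall>f\<in>B. \<exists>\<theta>. f \<in> laplacian_eigenspace G \<theta>) \<and>
     (\<forall>f\<in>B. \<forall>g\<in>B. f \<noteq> g \<longrightarrow> vertex_inner f g = 0)"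

lemma eigenfamily_vertex_functions: "eigenfamily B \<Longrightarrow> B \<subseteq> vertex_functions"
  by (auto simp: eigenfamily_def eigenspace_iff)

lemma eigenfamily_independent: "eigenfamily B \<Longrightarrow> \<not> fun_space.dependent B"
  using eigenfamily_vertex_functions[of B] unfolding eigenfamily_def by (intro orthogonal_independent) blast+

lemma eigenfamily_insert:
  assumes B: "eigenfamily B" and f: "f \<in> laplacian_eigenspace G \<theta>" "f \<noteq> 0" "\<And>b. b \<in> B \<Longrightarrow> vertex_inner f b = 0"
  shows "eigenfamily (insert f B)" "f \<notin> B"
proof -
  have "vertex_inner b f = 0" if "b \<in> B" for b using f(3)[OF that] by (simp add: vertex_inner_commute)
  then show "eigenfamily (insert f B)"
    using assms unfolding eigenfamily_def by auto
  show "f \<notin> B" using f vertex_inner_pos[of f] by (auto simp: eigenspace_iff)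
qed

text \<open>
  An orthogonal family of eigenfunctions of maximal size is a basis: its orthogonal complement is
  invariant under the Laplacian and would otherwise contain a further eigenfunction.
\<close>
lemma ex_eigenbasis:
  "\<exists>B. eigenfamily B \<and> card B = card (pverts G) \<and>
     (\<forall>\<theta>. \<forall>f \<in> laplacian_eigenspace G \<theta>. f \<noteq> 0 \<longrightarrow> B \<inter> laplacian_eigenspace G \<theta> \<noteq> {})"
proof -
  have "eigenfamily {}" by (simp add: eigenfamily_def)
  moreover have bound: "card B \<le> card (pverts G)" if "eigenfamily B" for B
    using independent_card_le(2) eigenfamily_independent[OF that] eigenfamily_vertex_functions[OF that] by blast
  ultimately have "\<exists>B. eigenfamily B \<and> (\<forall>B'. eigenfamily B' \<longrightarrow> card B' \<le> card B)"
    by (intro ex_has_greatest_nat[where k = "{}" and b = "Suc (card (pverts G))"]) (simp_all add: less_Suc_eq_le)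
  then obtain B where B: "eigenfamily B" and max: "\<And>B'. eigenfamily B' \<Longrightarrow> card B' \<le> card B" by blast
  have finB: "finite B" using B by (simp add: eigenfamily_def)
  have no: "\<exists>b\<in>B. vertex_inner f b \<noteq> 0" if "f \<in> laplacian_eigenspace G \<theta>" "f \<noteq> 0" for f \<theta>
  proof (rule ccontr)
    assume "\<not> ?thesis"
    then have "eigenfamily (insert f B)" "f \<notin> B" using eigenfamily_insert[OF B that] by blast+
    then show False using max[of "insert f B"] finB by simp
  qed
  show ?thesis
  proof (intro exI[of _ B] conjI B allI ballI impI)
    show "B \<inter> laplacian_eigenspace G \<theta> \<noteq> {}" if f: "f \<in> laplacian_eigenspace G \<theta>" "f \<noteq> 0" for f \<theta>
    proof -
      obtain b where b: "b \<in> B" "vertex_inner f b \<noteq> 0" using no[OF f] by blast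
      then obtain \<eta> where "b \<in> laplacian_eigenspace G \<eta>" using B by (auto simp: eigenfamily_def)
      then show ?thesis using eigenspaces_orthogonal[OF f(1)] b by blast
    qed
    show "card B = card (pverts G)"
    proof (rule ccontr)
      assume "card B \<noteq> card (pverts G)"
      then have "\<not> vertex_functions \<subseteq> fun_space.span B" using card_vertices_le_spanning[OF finB] bound[OF B] by linarith
      then obtain v where v: "v \<in> vertex_functions" "v \<notin> fun_space.span B" by blast
      \<comment> \<open>the component of \<open>v\<close> orthogonal to the family is a nonzero member of the invariant subspace \<open>U\<close>\<close>
      define U where "U = {f \<in> vertex_functions. \<forall>b\<in>B. vertex_inner f b = 0}"
      define c where "c b = vertex_inner v b / vertex_inner b b" for b
      define s where "s = (\<lambda>x. \<Sum>b\<in>B. c b * b x)"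
      define w where "w = (\<lambda>x. v x - s x)"
      have s_span: "s \<in> fun_space.span B"
      proof -
        have "s = (\<Sum>b\<in>B. (\<lambda>x. c b * b x))" by (simp add: s_def fun_eq_iff sum_fun_apply)
        also have "\<dots> \<in> fun_space.span B"
          by (intro fun_space.span_sum fun_space.span_scale fun_space.span_base)
        finally show ?thesis .
      qed
      have "w \<noteq> 0"
      proof
        assume "w = 0"
        then have "v = s" by (simp add: w_def fun_eq_iff)
        then show False using s_span v(2) by simp
      qed
      have Bx: "b x = 0" if "b \<in> B" "x \<notin> pverts G" for b x
        using eigenfamily_vertex_functions[OF B] that by (auto simp: vertex_functions_def)
      have "s x = 0" if "x \<notin> pverts G" for x
        unfolding s_def by (rule sum.neutral) (simp add: Bx that)
      then have "w \<in> vertex_functions" using v(1) by (simp add: w_def vertex_functions_def)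
      have "vertex_inner w b = 0" if b: "b \<in> B" for b
      proof -
        have "vertex_inner s b = (\<Sum>a\<in>B. c a * vertex_inner a b)" unfolding s_def by (rule vertex_inner_sum_left)
        also have "\<dots> = (\<Sum>a\<in>B. if a = b then c b * vertex_inner b b else 0)"
          using B b by (intro sum.cong) (auto simp: eigenfamily_def)
        also have "\<dots> = vertex_inner v b"
        proof -
          have "b \<noteq> 0" using B b unfolding eigenfamily_def by metis
          then have "vertex_inner b b > 0" using vertex_inner_pos eigenfamily_vertex_functions[OF B] b by blast
          then show ?thesis using finB b by (simp add: c_def)
        qed
        finally show ?thesis by (simp add: w_def vertex_inner_def left_diff_distrib sum_subtractf)
      qed
      then have w: "w \<in> U" using \<open>w \<in> vertex_functions\<close> by (simp add: U_def)
      have "\<exists>f \<theta>. f \<in> U \<and> f \<noteq> 0 \<and> f \<in> laplacian_eigenspace G \<theta>"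
      proof (rule invariant_subspace_eigenfunction[OF _ _ _ w \<open>w \<noteq> 0\<close>])
        show "U \<subseteq> vertex_functions" by (auto simp: U_def)
        show "(\<lambda>x. \<Sum>i\<le>n. c i * F i x) \<in> U" if "\<And>i. F i \<in> U" for c :: "nat \<Rightarrow> real" and F n
          using that by (auto simp: U_def vertex_inner_sum_left vertex_functions_def)
        show "vertex_laplacian f \<in> U" if f: "f \<in> U" for f
        proof -
          have "vertex_inner (vertex_laplacian f) b = 0" if b: "b \<in> B" for b
          proof -
            obtain \<theta> where "b \<in> laplacian_eigenspace G \<theta>" using B b by (auto simp: eigenfamily_def)
            then have "vertex_inner (vertex_laplacian b) f = - \<theta> * vertex_inner b f" by (rule vertex_inner_eigenfunction)
            then show ?thesis using f b vertex_inner_commute[of b f] vertex_inner_commute[of "vertex_laplacian b" f] by (simp add: vertex_laplacian_self_adjoint U_def)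
          qed
          then show ?thesis by (auto simp: U_def vertex_functions_def vertex_laplacian_def)
        qed
      qed
      then obtain f \<theta> where "f \<in> U" "f \<noteq> 0" "f \<in> laplacian_eigenspace G \<theta>" by blast
      then show False using no[of f \<theta>] by (auto simp: U_def)
    qed
  qed
qed

lemma eigenspace_disjoint:
  assumes "f \<in> laplacian_eigenspace G \<theta>" "f \<in> laplacian_eigenspace G \<eta>" "f \<noteq> 0"
  shows "\<theta> = \<eta>"
proof (rule ccontr)
  assume "\<theta> \<noteq> \<eta>"
  then have "vertex_inner f f = 0" by (rule eigenspaces_orthogonal[OF assms(1,2)])
  moreover have "f \<in> vertex_functions" using assms(1) by (simp add: eigenspace_iff)
  ultimately show False using vertex_inner_pos[OF _ assms(3)] by fastforce
qed

text \<open>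
  By maximality every eigenvalue occurs in the eigenbasis, and the members of the basis in one eigenspace
  are independent.
\<close>
lemma spectrum_total_multiplicity:
  shows "finite (laplacian_spectrum G)"
    and "card (pverts G) \<le> (\<Sum>\<theta>\<in>laplacian_spectrum G. laplacian_multiplicity G \<theta>)"
proof -
  from ex_eigenbasis obtain B where BB: "eigenfamily B \<and> card B = card (pverts G) \<and>
     (\<forall>\<theta>. \<forall>f \<in> laplacian_eigenspace G \<theta>. f \<noteq> 0 \<longrightarrow> B \<inter> laplacian_eigenspace G \<theta> \<noteq> {})" ..
  have B: "eigenfamily B" "card B = card (pverts G)" using BB by blast+
  have hit: "\<And>\<theta> f. f \<in> laplacian_eigenspace G \<theta> \<Longrightarrow> f \<noteq> 0 \<Longrightarrow> \<exists>b. b \<in> B \<and> b \<in> laplacian_eigenspace G \<theta>"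
    using conjunct2[OF conjunct2[OF BB]] by (metis disjoint_iff)
  have finB: "finite B" and B0: "0 \<notin> B" using B by (auto simp: eigenfamily_def)
  define ev where "ev b = (THE \<theta>. b \<in> laplacian_eigenspace G \<theta>)" for b
  have ev: "ev b = \<theta>" if "b \<in> B" "b \<in> laplacian_eigenspace G \<theta>" for b \<theta>
  proof -
    have "b \<noteq> 0" using that(1) B0 by metis
    then show ?thesis
      unfolding ev_def using that(2) eigenspace_disjoint[OF _ that(2)] by (intro the_equality)
  qed
  have "laplacian_spectrum G \<subseteq> ev ` B"
  proof
    fix \<theta> assume "\<theta> \<in> laplacian_spectrum G"
    then obtain f where "f \<in> laplacian_eigenspace G \<theta>" "f \<noteq> 0" by (auto simp: laplacian_spectrum_def)
    then obtain b where b: "b \<in> B" "b \<in> laplacian_eigenspace G \<theta>" using hit by blast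
    show "\<theta> \<in> ev ` B" using ev[OF b] b(1) by (metis imageI)
  qed
  then show fin: "finite (laplacian_spectrum G)" using finB finite_subset by blast
  have "B = (\<Union>\<theta>\<in>laplacian_spectrum G. B \<inter> laplacian_eigenspace G \<theta>)"
  proof
    show "B \<subseteq> (\<Union>\<theta>\<in>laplacian_spectrum G. B \<inter> laplacian_eigenspace G \<theta>)"
    proof
      fix b assume b: "b \<in> B"
      then obtain \<theta> where "b \<in> laplacian_eigenspace G \<theta>" using B by (auto simp: eigenfamily_def)
      moreover have "b \<noteq> 0" using b B0 by metis
      ultimately show "b \<in> (\<Union>\<theta>\<in>laplacian_spectrum G. B \<inter> laplacian_eigenspace G \<theta>)"
        using b unfolding laplacian_spectrum_def by blast
    qed
  qed blast
  then have "card B = card (\<Union>\<theta>\<in>laplacian_spectrum G. B \<inter> laplacian_eigenspace G \<theta>)"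
    by (rule arg_cong)
  also have "\<dots> \<le> (\<Sum>\<theta>\<in>laplacian_spectrum G. card (B \<inter> laplacian_eigenspace G \<theta>))"
    by (rule card_UN_le[OF fin])
  also have "\<dots> \<le> (\<Sum>\<theta>\<in>laplacian_spectrum G. laplacian_multiplicity G \<theta>)"
  proof (intro sum_mono card_le_multiplicity)
    show "\<not> fun_space.dependent (B \<inter> laplacian_eigenspace G \<theta>)" for \<theta>
      using eigenfamily_independent[OF B(1)] fun_space.independent_mono by blast
  qed auto
  finally show "card (pverts G) \<le> (\<Sum>\<theta>\<in>laplacian_spectrum G. laplacian_multiplicity G \<theta>)"
    by (simp add: B(2))
qed

lemma size_laplacian_eigenvalues: "card (pverts G) \<le> size (laplacian_eigenvalues G)"
  using spectrum_total_multiplicity by (simp add: laplacian_eigenvalues_def size_multiset_sum)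

lemma count_laplacian_eigenvalues:
  "count (laplacian_eigenvalues G) \<theta>
     = (if \<theta> \<in> laplacian_spectrum G then laplacian_multiplicity G \<theta> else 0)"
  using spectrum_total_multiplicity(1) by (simp add: laplacian_eigenvalues_def count_sum)

lemma max_degree_less_card:
  assumes "pverts G \<noteq> {}"
  shows "max_degree G < card (pverts G)"
proof -
  obtain x where x: "x \<in> pverts G" "card (nbrs G x) = max_degree G" using max_degree_attained[OF assms] .
  have "nbrs G x \<subset> pverts G" using x nbrs_verts nbrs_irrefl by blast
  then show ?thesis using psubset_card_mono[OF pair_finite_verts] x(2) by metis
qed

end

section \<open>Counting eigenvalues below and at the curvature bound\<close>

context curvature_two_graph
begin

lemma eigenvalue_less_2:
  assumes "\<theta> \<in># laplacian_eigenvalues G" "\<theta> < 2"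
  shows "\<theta> = 0"
proof -
  have "\<theta> \<in> laplacian_spectrum G"
    using assms(1) count_laplacian_eigenvalues[of \<theta>] by (metis count_eq_zero_iff)
  then obtain f where f: "f \<in> laplacian_eigenspace G \<theta>" "f \<noteq> 0" by (auto simp: laplacian_spectrum_def)
  have eig: "laplacian G f y = - \<theta> * f y" if "y \<in> pverts G" for y
    using f(1) that by (force simp: laplacian_eigenspace_def)
  obtain x where x: "x \<in> pverts G" "f x \<noteq> 0"
    using f by (auto simp: laplacian_eigenspace_def fun_eq_iff)
  have "f y = f x" if "y \<in> nbrs G x" for y
    using eigenfunction_const_if_less[OF conn CD2 assms(2) eig] that x nbrs_verts by blast
  then have "laplacian G f x = 0" by (simp add: laplacian_nbrs)
  then show ?thesis using eig[OF x(1)] x(2) by simp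
qed

lemma multiplicity_0: "laplacian_multiplicity G 0 \<le> 1"
proof -
  define e where "e = (\<lambda>x. if x \<in> pverts G then 1 else (0::real))"
  have "laplacian_eigenspace G 0 \<subseteq> fun_space.span {e}"
  proof
    fix f assume f: "f \<in> laplacian_eigenspace G 0"
    obtain x where x: "x \<in> pverts G" using connected_nonempty[OF conn] by blast
    have "f y = f x" if "y \<in> pverts G" for y
      using harmonic_const[OF conn _ that x] f by (simp add: laplacian_eigenspace_def)
    then have "f = (\<lambda>y. f x * e y)" using f by (auto simp: e_def fun_eq_iff laplacian_eigenspace_def)
    also have "\<dots> \<in> fun_space.span {e}" by (intro fun_space.span_scale fun_space.span_base) simp
    finally show "f \<in> fun_space.span {e}" .
  qed
  then show ?thesis unfolding laplacian_multiplicity_def using fun_space.dim_le_card[of _ "{e}"] by simp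
qed

lemma zero_eigenvalue: "0 \<in># laplacian_eigenvalues G"
proof -
  define e where "e = (\<lambda>x. if x \<in> pverts G then 1 else (0::real))"
  have nb: "e y = 1" if "x \<in> pverts G" "y \<in> nbrs G x" for x y using that nbrs_verts by (auto simp: e_def)
  have e: "e \<in> laplacian_eigenspace G 0" 
    by (auto simp: laplacian_eigenspace_def laplacian_nbrs nb) (auto simp: e_def)
  obtain x where "x \<in> pverts G" using connected_nonempty[OF conn] by blast
  then have "e \<noteq> 0" by (auto simp: e_def fun_eq_iff)
  then have "\<not> fun_space.dependent {e}" by simp
  then have "1 \<le> laplacian_multiplicity G 0" using card_le_multiplicity[of "{e}" 0] e by simp
  moreover have "0 \<in> laplacian_spectrum G" using e \<open>e \<noteq> 0\<close> by (auto simp: laplacian_spectrum_def)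
  ultimately have "count (laplacian_eigenvalues G) 0 \<noteq> 0" by (simp add: count_laplacian_eigenvalues)
  then show ?thesis by (metis count_eq_zero_iff)
qed

text \<open>
  The first \<open>\<Delta>\<close> entries of the sorted list are at most 2, and only one of them can be smaller: the
  simple eigenvalue 0.  The list does have an entry with index \<open>\<Delta> - 1\<close>, because its length is at least the
  number of vertices.
\<close>
lemma eigenvalue_2_multiplicity:
  assumes ev: "laplacian_eigenvalue G (max_degree G - 1) = 2"
  shows "max_degree G \<ge> 1" "max_degree G - 1 \<le> laplacian_multiplicity G 2"
proof -
  define M where "M = laplacian_eigenvalues G"
  define xs where "xs = sorted_list_of_multiset M"
  define k where "k = max_degree G - 1"
  have xs: "mset xs = M" "sorted xs" by (simp_all add: xs_def)
  have xk: "xs ! k = 2" using ev by (simp add: laplacian_eigenvalue_def xs_def M_def k_def)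
  have "length xs = size M" using xs(1) size_mset by metis
  then have len: "max_degree G < length xs"
    using max_degree_less_card[OF connected_nonempty[OF conn]] size_laplacian_eigenvalues by (simp add: M_def)
  then have klen: "k < length xs" by (simp add: k_def)
  have small: "length (filter (\<lambda>\<theta>. \<theta> < 2) xs) \<le> 1"
  proof -
    have "length (filter (\<lambda>\<theta>. \<theta> < 2) xs) = size (filter_mset (\<lambda>\<theta>. \<theta> < 2) M)"
      by (metis mset_filter size_mset xs(1))
    also have "filter_mset (\<lambda>\<theta>. \<theta> < 2) M = filter_mset (\<lambda>\<theta>. \<theta> = 0) M"
      using eigenvalue_less_2 by (intro filter_mset_cong) (auto simp: M_def)
    also have "size \<dots> = count M 0" by (simp add: filter_eq_replicate_mset)
    also have "\<dots> \<le> 1" using multiplicity_0 by (simp add: M_def count_laplacian_eigenvalues)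
    finally show ?thesis .
  qed
  \<comment> \<open>for maximal degree 0 the index \<open>\<Delta> - 1\<close> is 0 as well, and the first entry of the list is not 2\<close>
  show "max_degree G \<ge> 1"
  proof (rule ccontr)
    assume "\<not> ?thesis"
    then have "k = 0" by (simp add: k_def)
    have "0 \<in> set xs" using zero_eigenvalue xs(1) by (metis M_def set_mset_mset)
    then obtain i where "i < length xs" "xs ! i = 0" by (auto simp: in_set_conv_nth)
    then have "xs ! 0 \<le> 0" using sorted_nth_mono[OF xs(2), of 0 i] by simp
    then show False using xk \<open>k = 0\<close> by simp
  qed
  define ys where "ys = take (Suc k) xs"
  have ys: "length ys = Suc k" using klen by (simp add: ys_def)
  have le: "\<theta> \<le> 2" if \<theta>: "\<theta> \<in> set ys" for \<theta>
  proof -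
    obtain i where i: "i < length ys" "ys ! i = \<theta>" using \<theta> unfolding in_set_conv_nth by blast
    have ik: "i < Suc k" using i(1) unfolding ys .
    have "xs ! i = \<theta>" using i(2) ik unfolding ys_def by (simp only: nth_take)
    moreover have "xs ! i \<le> xs ! k" using sorted_nth_mono[OF xs(2), of i k] klen ik by simp
    ultimately show ?thesis unfolding xk by simp
  qed
  have "length (filter Q ys) \<le> length (filter Q xs)" for Q
  proof -
    have "xs = ys @ drop (Suc k) xs" by (simp add: ys_def)
    then have "filter Q xs = filter Q ys @ filter Q (drop (Suc k) xs)" by (metis filter_append)
    then show ?thesis by simp
  qed
  note sub = this
  have "Suc k = length (filter (\<lambda>\<theta>. \<theta> < 2) ys) + length (filter (\<lambda>\<theta>. \<not> \<theta> < 2) ys)"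
    using ys sum_length_filter_compl[of "\<lambda>\<theta>. \<theta> < 2" ys] by simp
  also have "filter (\<lambda>\<theta>. \<not> \<theta> < 2) ys = filter (\<lambda>\<theta>. \<theta> = 2) ys"
    using le by (intro filter_cong) fastforce+
  also have "length (filter (\<lambda>\<theta>. \<theta> < 2) ys) + length (filter (\<lambda>\<theta>. \<theta> = 2) ys) \<le> 1 + count M 2"
  proof -
    have "filter (\<lambda>\<theta>. \<theta> = 2) xs = filter ((=) 2) xs" by (rule filter_cong) auto
    then have "length (filter (\<lambda>\<theta>. \<theta> = 2) xs) = count M 2"
      unfolding xs(1)[symmetric] by (simp add: count_mset count_list_eq_length_filter)
    then show ?thesis using sub[of "\<lambda>\<theta>. \<theta> < 2"] sub[of "\<lambda>\<theta>. \<theta> = 2"] small by linarith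
  qed
  finally have "k \<le> count M 2" by simp
  then show "max_degree G - 1 \<le> laplacian_multiplicity G 2"
    by (simp add: M_def k_def count_laplacian_eigenvalues split: if_splits)
qed

end

section \<open>Projections of corank at most one\<close>

text \<open>
  The trace of a symmetric idempotent matrix is the sum of the squares of its entries.
\<close>
lemma projection_trace_zero:
  fixes R :: "'a \<Rightarrow> 'a \<Rightarrow> real"
  assumes "finite N" and sym: "\<And>u w. R u w = R w u"
    and idem: "\<And>u v. u \<in> N \<Longrightarrow> v \<in> N \<Longrightarrow> (\<Sum>w\<in>N. R u w * R w v) = R u v"
    and tr: "(\<Sum>u\<in>N. R u u) = 0" and "u \<in> N" "w \<in> N"
  shows "R u w = 0"
proof -
  have sq: "R u u = (\<Sum>w\<in>N. R u w * R u w)" if "u \<in> N" for u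
    using idem[OF that that] sym by simp
  then have "R u u \<ge> 0" if "u \<in> N" for u using that by (simp add: sum_nonneg)
  then have "R u u = 0" using tr \<open>finite N\<close> \<open>u \<in> N\<close> by (simp add: sum_nonneg_eq_0_iff)
  then have "(\<Sum>w\<in>N. R u w * R u w) = 0" using sq[OF \<open>u \<in> N\<close>] by simp
  then show ?thesis using \<open>finite N\<close> \<open>w \<in> N\<close> by (simp add: sum_nonneg_eq_0_iff)
qed

text \<open>
  The rows \<open>a i\<close> are orthonormal, so \<open>R = I - a\<^sup>T a\<close> is the projection onto the orthogonal
  complement of their span, and its trace \<open>card N - m\<close> is 0 or 1.  In the first case \<open>R = 0\<close>.  In the second,
  normalising a nonzero column of \<open>R\<close> gives a unit vector \<open>n\<close>, and \<open>R - n n\<^sup>T\<close> is a projection of trace 0.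
\<close>
lemma projection_codim_le_one:
  fixes a :: "nat \<Rightarrow> 'a \<Rightarrow> real"
  assumes fin: "finite N" and le: "card N \<le> Suc m"
    and on: "\<And>i j. i < m \<Longrightarrow> j < m \<Longrightarrow> (\<Sum>u\<in>N. a i u * a j u) = (if i = j then 1 else 0)"
  obtains n where "\<And>u w. u \<in> N \<Longrightarrow> w \<in> N \<Longrightarrow> (\<Sum>i<m. a i u * a i w) = (if u = w then 1 else 0) - n u * n w"
    and "(\<Sum>u\<in>N. (n u)\<^sup>2) = real (card N) - real m"
proof -
  define P where "P u w = (\<Sum>i<m. a i u * a i w)" for u w
  define R where "R u w = (if u = w then 1 else 0) - P u w" for u w
  have symP: "P u w = P w u" for u w by (simp add: P_def mult.commute)
  have symR: "R u w = R w u" for u w by (simp add: R_def symP)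
  have PP: "(\<Sum>w\<in>N. P u w * P w v) = P u v" for u v
  proof -
    have "(\<Sum>w\<in>N. P u w * P w v) = (\<Sum>w\<in>N. \<Sum>i<m. \<Sum>j<m. (a i u * a j v) * (a i w * a j w))"
      by (simp add: P_def sum_product algebra_simps)
    also have "\<dots> = (\<Sum>i<m. \<Sum>w\<in>N. \<Sum>j<m. (a i u * a j v) * (a i w * a j w))"
      by (rule sum.swap)
    also have "\<dots> = (\<Sum>i<m. \<Sum>j<m. \<Sum>w\<in>N. (a i u * a j v) * (a i w * a j w))"
      by (intro sum.cong refl sum.swap)
    also have "\<dots> = (\<Sum>i<m. \<Sum>j<m. (a i u * a j v) * (if i = j then 1 else 0))"
      by (intro sum.cong refl) (simp add: sum_distrib_left[symmetric] on)
    also have "\<dots> = (\<Sum>i<m. \<Sum>j<m. if j = i then a i u * a i v else 0)"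
      by (intro sum.cong refl) auto
    also have "\<dots> = P u v" by (simp add: P_def)
    finally show ?thesis .
  qed
  have RR: "(\<Sum>w\<in>N. R u w * R w v) = R u v" if "u \<in> N" "v \<in> N" for u v
  proof -
    have "(\<Sum>w\<in>N. R u w * R w v) = (\<Sum>w\<in>N. (if u = w then (if w = v then 1 else 0) - P w v else 0)
        - (if w = v then P u w else 0) + P u w * P w v)"
      by (intro sum.cong) (auto simp: R_def algebra_simps)
    also have "\<dots> = R u v"
      using that fin by (simp add: sum.distrib sum_subtractf PP R_def)
    finally show ?thesis .
  qed
  have trP: "(\<Sum>u\<in>N. P u u) = real m"
  proof -
    have "(\<Sum>u\<in>N. P u u) = (\<Sum>i<m. \<Sum>u\<in>N. a i u * a i u)" unfolding P_def by (rule sum.swap)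
    then show ?thesis by (simp add: on)
  qed
  have trR: "(\<Sum>u\<in>N. R u u) = real (card N) - real m"
    by (simp add: R_def sum_subtractf trP)
  have sq: "R u u = (\<Sum>w\<in>N. R u w * R u w)" if "u \<in> N" for u
    using RR[OF that that] symR by simp
  then have nonneg: "R u u \<ge> 0" if "u \<in> N" for u using that by (simp add: sum_nonneg)
  show thesis
  proof (cases "card N \<le> m")
    case True
    have "(\<Sum>u\<in>N. R u u) \<ge> 0" using nonneg by (rule sum_nonneg)
    then have eq: "card N = m" using True trR by simp
    then have "R u w = 0" if "u \<in> N" "w \<in> N" for u w
      using projection_trace_zero[of N R, OF fin symR RR] trR that by simp
    then show ?thesis using eq that[of "\<lambda>_. 0"] by (simp add: R_def P_def)
  next
    case False
    then have tr1: "card N = Suc m" using le by simp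
    then have "\<exists>z\<in>N. R z z \<noteq> 0" using trR by (metis (no_types, lifting) add_diff_cancel_left' of_nat_Suc sum.neutral zero_neq_one add.commute)
    then obtain z where z: "z \<in> N" "R z z > 0" using nonneg by force
    \<comment> \<open>the column of \<open>z\<close> has squared length \<open>R z z\<close>, as \<open>R\<close> is idempotent\<close>
    define n where "n u = R u z / sqrt (R z z)" for u
    have nn: "n u * n w = R u z * R z w / R z z" for u w
      using z(2) symR[of w z] by (simp add: n_def)
    have tr_n: "(\<Sum>u\<in>N. n u * n u) = 1"
      using sq[OF z(1)] symR z(2) by (simp add: nn sum_divide_distrib[symmetric])
    define R' where "R' u w = R u w - n u * n w" for u w
    have "R' u w = 0" if "u \<in> N" "w \<in> N" for u w
    proof (rule projection_trace_zero[of N R', OF fin _ _ _ that])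
      show "R' u w = R' w u" for u w by (simp add: R'_def symR)
      show "(\<Sum>u\<in>N. R' u u) = 0" by (simp add: R'_def sum_subtractf trR tr_n tr1)
      fix u v assume uv: "u \<in> N" "v \<in> N"
      have Rn: "(\<Sum>w\<in>N. R u w * n w) = n u" if "u \<in> N" for u
        using RR[OF that z(1)] by (simp add: n_def sum_divide_distrib[symmetric])
      have "(\<Sum>w\<in>N. R' u w * R' w v)
          = (\<Sum>w\<in>N. R u w * R w v - n v * (R u w * n w) - n u * (R v w * n w) + (n u * n v) * (n w * n w))"
        using symR[of v] by (intro sum.cong) (auto simp: R'_def algebra_simps)
      also have "\<dots> = R' u v"
        using uv by (simp add: sum.distrib sum_subtractf sum_distrib_left[symmetric] Rn tr_n RR R'_def)
      finally show "(\<Sum>w\<in>N. R' u w * R' w v) = R' u v" .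
    qed
    then show ?thesis
      using that[of n] tr_n tr1 by (simp add: R'_def R_def P_def power2_eq_square algebra_simps)
  qed
qed

section \<open>The eigenmap: regularity and absence of triangles\<close>

text \<open>
  The coordinates \<open>p i\<close> stem from eigenfunctions that are orthonormal for \<open>2 \<Gamma>\<close> at every vertex.  The matrix of the
  differences along the edges at \<open>x\<close> thus has orthonormal rows, and \<open>Gram\<close> states the consequence for its columns: they are
  the projections of an orthonormal basis along the normal vector \<open>n x\<close>, which is a unit vector or zero by
  \<open>norm_n\<close>.  The assumptions \<open>dist2\<close> and \<open>edge\<close> are the two identities that express equality in the curvature bound.
\<close>
locale isometric_eigenmap = pair_graph +
  fixes m :: nat and p :: "nat \<Rightarrow> 'a \<Rightarrow> real" and n :: "'a \<Rightarrow> 'a \<Rightarrow> real"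
  assumes conn: "Digraph_Component.connected (with_proj G)"
    and max_deg: "max_degree G = Suc m"
    and Gram: "\<And>x u w. \<lbrakk>x \<in> pverts G; u \<in> nbrs G x; w \<in> nbrs G x\<rbrakk> \<Longrightarrow>
        (\<Sum>i<m. (p i u - p i x) * (p i w - p i x)) = (if u = w then 1 else 0) - n x u * n x w"
    and norm_n: "\<And>x. x \<in> pverts G \<Longrightarrow> (\<Sum>u\<in>nbrs G x. (n x u)\<^sup>2) = real (card (nbrs G x)) - real m"
    and dist2: "\<And>i x z. \<lbrakk>i < m; x \<in> pverts G; z \<notin> nbrs G x; z \<noteq> x\<rbrakk> \<Longrightarrow>
        card (nbrs G x \<inter> nbrs G z) * (p i z + p i x) = 2 * (\<Sum>y\<in>nbrs G x \<inter> nbrs G z. p i y)"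
    and edge: "\<And>i x y. \<lbrakk>i < m; x \<in> pverts G; y \<in> nbrs G x\<rbrakk> \<Longrightarrow>
        (\<Sum>w\<in>nbrs G x \<inter> nbrs G y. p i y + p i x - 2 * p i w)
          + (real (card (nbrs G y)) - real (card (nbrs G x))) * (p i y - p i x) = 0"
begin

abbreviation V where "V \<equiv> pverts G"
abbreviation N where "N \<equiv> nbrs G"

lemma in_V: "y \<in> N x \<Longrightarrow> x \<in> V" "y \<in> N x \<Longrightarrow> y \<in> V"
  using nbrs_verts nbrs_sym by blast+

definition edge_gram :: "'a \<Rightarrow> 'a \<Rightarrow> 'a \<Rightarrow> real" where
  "edge_gram x u w = (\<Sum>i<m. (p i u - p i x) * (p i w - p i x))"

lemma edge_gram_nbrs: "u \<in> N x \<Longrightarrow> w \<in> N x \<Longrightarrow> edge_gram x u w = (if u = w then 1 else 0) - n x u * n x w"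
  unfolding edge_gram_def by (rule Gram) (auto dest: in_V)

text \<open>
  The inner product of the relation with each edge vector gives \<open>c = \<langle>c, n\<rangle> n\<close>.  So there is at
  most one relation among the edge vectors at \<open>x\<close>, up to a factor.
\<close>
lemma relation_normal:
  assumes x: "x \<in> V" and rel: "\<And>i. i < m \<Longrightarrow> (\<Sum>u\<in>N x. c u * (p i u - p i x)) = 0"
  obtains \<kappa> where "\<And>w. w \<in> N x \<Longrightarrow> c w = \<kappa> * n x w"
proof (rule that)
  fix w assume w: "w \<in> N x"
  have "0 = (\<Sum>i<m. (\<Sum>u\<in>N x. c u * (p i u - p i x)) * (p i w - p i x))" by (simp add: rel)
  also have "\<dots> = (\<Sum>u\<in>N x. c u * edge_gram x u w)"
    unfolding edge_gram_def sum_distrib_left sum_distrib_right by (subst sum.swap) (simp add: mult.assoc)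
  also have "\<dots> = (\<Sum>u\<in>N x. (if u = w then c u else 0) - (c u * n x u) * n x w)"
    by (intro sum.cong refl) (simp add: edge_gram_nbrs w algebra_simps)
  also have "\<dots> = c w - (\<Sum>u\<in>N x. c u * n x u) * n x w"
    using w finite_nbrs by (simp add: sum_subtractf sum_distrib_right)
  finally show "c w = (\<Sum>u\<in>N x. c u * n x u) * n x w" by simp
qed

text \<open>
  The edge identity, read as a relation among the edge vectors at \<open>x\<close>.
\<close>
lemma edge_relation:
  assumes y: "y \<in> N x"
  obtains \<kappa> where
    "real (card (N x \<inter> N y)) + (real (card (N y)) - real (card (N x))) = \<kappa> * n x y"
    "\<And>w. w \<in> N x \<inter> N y \<Longrightarrow> - 2 = \<kappa> * n x w"
    "\<And>w. w \<in> N x - N y - {y} \<Longrightarrow> 0 = \<kappa> * n x w"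
proof -
  let ?C = "N x \<inter> N y"
  define t where "t = real (card ?C) + (real (card (N y)) - real (card (N x)))"
  define c where "c u = (if u = y then t else if u \<in> N y then - 2 else (0::real))" for u
  have x: "x \<in> V" using y in_V by blast
  have yC: "y \<notin> N y" by (rule nbrs_irrefl)
  have "(\<Sum>u\<in>N x. c u * (p i u - p i x)) = 0" if i: "i < m" for i
  proof -
    let ?v = "\<lambda>u. p i u - p i x"
    have "(\<Sum>u\<in>N x. c u * ?v u) = t * ?v y + (\<Sum>u\<in>N x - {y}. c u * ?v u)"
      using y finite_nbrs by (simp add: sum.remove c_def)
    also have "(\<Sum>u\<in>N x - {y}. c u * ?v u) = (\<Sum>u\<in>N x - {y}. if u \<in> N y then - 2 * ?v u else 0)"
      by (intro sum.cong) (auto simp: c_def)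
    also have "\<dots> = (\<Sum>u\<in>?C. - 2 * ?v u)"
    proof -
      have "(N x - {y}) \<inter> {u. u \<in> N y} = ?C" using yC by blast
      then show ?thesis by (simp add: sum.If_cases finite_nbrs)
    qed
    finally have "(\<Sum>u\<in>N x. c u * ?v u) = t * ?v y + (\<Sum>u\<in>?C. - 2 * ?v u)" .
    moreover have "(\<Sum>w\<in>?C. p i y + p i x - 2 * p i w) = card ?C * ?v y + (\<Sum>u\<in>?C. - 2 * ?v u)"
      by (simp add: sum.distrib sum_subtractf sum_distrib_left algebra_simps)
    ultimately show ?thesis using edge[OF i x y] by (simp add: t_def algebra_simps)
  qed
  then obtain \<kappa> where k: "\<And>w. w \<in> N x \<Longrightarrow> c w = \<kappa> * n x w" using relation_normal[OF x] by blast
  show ?thesis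
  proof (rule that[of \<kappa>])
    show "real (card ?C) + (real (card (N y)) - real (card (N x))) = \<kappa> * n x y"
      using k[OF y] by (simp add: c_def t_def)
    show "- 2 = \<kappa> * n x w" if "w \<in> ?C" for w
      using k[of w] that yC by (auto simp: c_def split: if_splits)
    show "0 = \<kappa> * n x w" if "w \<in> N x - N y - {y}" for w
      using k[of w] that by (auto simp: c_def)
  qed
qed

text \<open>
  At a vertex of degree \<open>m\<close> the normal vector is zero and the relations of its edges are trivial,
  which forces all neighbours to have degree \<open>m\<close> as well.  By connectedness no vertex would have the maximal
  degree \<open>m + 1\<close>.
\<close>
lemma regular:
  assumes "x \<in> V"
  shows "card (N x) = Suc m"
proof (rule ccontr)
  have ge: "card (N u) \<ge> m" if "u \<in> V" for u
    using norm_n[OF that] sum_nonneg[of "N u" "\<lambda>w. (n u w)\<^sup>2"] by simp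
  assume "card (N x) \<noteq> Suc m"
  then have card_x: "card (N x) = m"
    using ge[OF assms] card_nbrs_le_max_degree[OF assms] max_deg by simp
  have "card (N y) = m" if y: "y \<in> V" for y
  proof (rule connected_induct[where P = "\<lambda>v. card (N v) = m", OF conn assms card_x y])
    fix u v assume u: "u \<in> V" and v: "v \<in> N u" and card_u: "card (N u) = m"
    have "n u w = 0" if "w \<in> N u" for w
      using norm_n[OF u] card_u that finite_nbrs by (simp add: sum_nonneg_eq_0_iff)
    then obtain \<kappa> :: real where
      "real (card (N u \<inter> N v)) + (real (card (N v)) - real (card (N u))) = 0"
      and "\<And>w. w \<in> N u \<inter> N v \<Longrightarrow> - 2 = (0::real)"
      using edge_relation[OF v] v by (metis IntD1 mult_zero_right)
    moreover from this(2) have "N u \<inter> N v = {}" by fastforce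
    ultimately show "card (N v) = m" using card_u by simp
  qed
  then show False
    using max_degree_attained[OF connected_nonempty[OF conn]] max_deg n_not_Suc_n by force
qed

lemma unit_n: "x \<in> V \<Longrightarrow> (\<Sum>u\<in>N x. (n x u)\<^sup>2) = 1"
  by (simp add: norm_n regular)

lemma triangle_relation:
  assumes y: "y \<in> N x"
  obtains \<kappa> where
    "real (card (N x \<inter> N y)) = \<kappa> * n x y"
    "\<And>w. w \<in> N x \<inter> N y \<Longrightarrow> - 2 = \<kappa> * n x w"
    "\<And>w. w \<in> N x - N y - {y} \<Longrightarrow> 0 = \<kappa> * n x w"
proof -
  have "card (N y) = card (N x)" using in_V[OF y] by (simp add: regular)
  then show ?thesis using edge_relation[OF y] that by (metis add.right_neutral diff_self)
qed

text \<open>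
  Suppose \<open>xy\<close> has two common neighbours \<open>w\<close> and \<open>w'\<close>.  In the relation of \<open>xy\<close> they have the same
  coefficient, so \<open>n\<close> agrees there.  In the relation of \<open>xw\<close> the coefficient of \<open>w\<close> is positive
  and that of \<open>w'\<close> is not.
\<close>
lemma card_triangle_le_one:
  assumes w: "w \<in> N x \<inter> N y" and y: "y \<in> N x"
  shows "N x \<inter> N y = {w}"
proof (rule ccontr)
  assume "N x \<inter> N y \<noteq> {w}"
  then obtain w' where w': "w' \<in> N x \<inter> N y" "w' \<noteq> w" using w by blast
  obtain k where k: "- 2 = k * n x w" "- 2 = k * n x w'"
    using triangle_relation[OF y] w w' by metis
  have "w \<in> N x" "y \<in> N x \<inter> N w" using w y nbrs_sym by blast+
  then obtain k' where k': "real (card (N x \<inter> N w)) = k' * n x w" "- 2 = k' * n x y"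
     "\<And>u. u \<in> N x \<inter> N w \<Longrightarrow> - 2 = k' * n x u"
    "\<And>u. u \<in> N x - N w - {w} \<Longrightarrow> 0 = k' * n x u"
    using triangle_relation[OF \<open>w \<in> N x\<close>] by metis
  have "w' \<noteq> w \<and> w' \<in> N x" using w' by blast
  from k have "k \<noteq> 0" by auto
  then have eq: "n x w' = n x w" using k by (metis mult_cancel_left)
  have "k' * n x w' \<le> 0" using k'(3)[of w'] k'(4)[of w'] w' by fastforce
  then have "card (N x \<inter> N w) = 0" using eq k'(1) by simp
  then show False using \<open>y \<in> N x \<inter> N w\<close> finite_nbrs by auto
qed

text \<open>
  In a triangle \<open>x, y, w\<close> without further common neighbours, the relation of \<open>xy\<close> makes the
  components of \<open>n x\<close> at \<open>y\<close> and \<open>w\<close> proportional to \<open>1\<close> and \<open>-2\<close>, whereas that of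
  \<open>xw\<close> makes them proportional to \<open>-2\<close> and \<open>1\<close>.
\<close>
lemma triangle_free:
  assumes y: "y \<in> N x"
  shows "N x \<inter> N y = {}"
proof (rule ccontr)
  assume "N x \<inter> N y \<noteq> {}"
  then obtain w where w: "w \<in> N x \<inter> N y" by blast
  obtain k where k: "1 = k * n x y" "- 2 = k * n x w"
  proof (rule triangle_relation[OF y])
    fix k assume "real (card (N x \<inter> N y)) = k * n x y" "\<And>w. w \<in> N x \<inter> N y \<Longrightarrow> - 2 = k * n x w"
    then show thesis using that[of k] w card_triangle_le_one[OF w y] by simp
  qed
  have w': "w \<in> N x" "y \<in> N x \<inter> N w" using w y nbrs_sym by blast+
  obtain k' where k': "1 = k' * n x w" "- 2 = k' * n x y"
  proof (rule triangle_relation[OF w'(1)])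
    fix k assume "real (card (N x \<inter> N w)) = k * n x w" "\<And>u. u \<in> N x \<inter> N w \<Longrightarrow> - 2 = k * n x u"
    then show thesis using that[of k] w' card_triangle_le_one[OF w'(2,1)] by simp
  qed
  have "(k * n x y) * (k' * n x w) = (k * n x w) * (k' * n x y)" by simp
  then show False using k k' by simp
qed

section \<open>The eigenmap: codegrees at distance two\<close>

abbreviation codegree where "codegree x z \<equiv> card (N x \<inter> N z)"
abbreviation normal_sum where "normal_sum x z \<equiv> \<Sum>w\<in>N x \<inter> N z. n x w"

lemma two_step:
  assumes y: "y \<in> N x" and z: "z \<in> N y" "z \<noteq> x"
  shows "z \<notin> N x" "y \<in> N x \<inter> N z" "codegree x z \<ge> 1"
proof -
  show "z \<notin> N x" using triangle_free[OF y] z by blast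
  show *: "y \<in> N x \<inter> N z" using y z nbrs_sym by blast
  have "codegree x z \<noteq> 0" using * finite_nbrs by auto
  then show "codegree x z \<ge> 1" by simp
qed

lemma two_step_sum:
  assumes "y \<in> N x" "z \<in> N y" "z \<noteq> x" "i < m"
  shows "codegree x z * (p i z + p i x) = 2 * (\<Sum>y\<in>N x \<inter> N z. p i y)"
  using dist2[OF \<open>i < m\<close>] two_step[OF assms(1-3)] in_V assms by blast

text \<open>
  The vector of an edge has the same length from both ends.
\<close>
lemma n_edge_sym:
  assumes y: "y \<in> N x"
  shows "(n y x)\<^sup>2 = (n x y)\<^sup>2"
proof -
  have x: "x \<in> N y" using y nbrs_sym by blast
  have "edge_gram y x x = edge_gram x y y" by (simp add: edge_gram_def algebra_simps)
  then show ?thesis using edge_gram_nbrs[OF y y] edge_gram_nbrs[OF x x] by (simp add: power2_eq_square)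
qed

text \<open>
  The identity at distance two expresses \<open>p z - p y\<close> by edge vectors at \<open>x\<close>.  Its inner products with
  itself and with \<open>p x - p y\<close> are also known from the Gram matrix at \<open>y\<close>.
\<close>
lemma n_two_step:
  assumes y: "y \<in> N x" and z: "z \<in> N y" "z \<noteq> x"
  shows n_two_step_sq: "(n y z)\<^sup>2 = (n x y - 2 * normal_sum x z / codegree x z)\<^sup>2"
    and n_two_step_prod: "n y x * n y z = n x y * (n x y - 2 * normal_sum x z / codegree x z) - (1 - 2 / codegree x z)"
proof -
  let ?C = "N x \<inter> N z"
  define d where "d = real (codegree x z)"
  define s where "s = normal_sum x z"
  note yz = two_step[OF y z]
  have d: "d \<ge> 1" using yz(3) by (simp add: d_def)
  have xy: "x \<in> N y" using y nbrs_sym by blast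
  define a where "a i = (\<Sum>w\<in>?C. p i w - p i x)" for i
  define b where "b i = p i y - p i x" for i
  define k where "k = 2 / d"
  have pz: "p i z - p i y = k * a i - b i" if "i < m" for i
  proof -
    have "d * (p i z + p i x) = 2 * (a i + d * p i x)"
      using two_step_sum[OF y z that] by (simp add: a_def sum_subtractf d_def)
    then show ?thesis using d by (simp add: b_def k_def field_simps)
  qed
  have aa: "(\<Sum>i<m. a i * a i) = d - s\<^sup>2"
  proof -
    have "(\<Sum>i<m. a i * a i) = (\<Sum>i<m. \<Sum>u\<in>?C. \<Sum>w\<in>?C. (p i u - p i x) * (p i w - p i x))"
      by (simp add: a_def sum_product)
    also have "\<dots> = (\<Sum>u\<in>?C. \<Sum>i<m. \<Sum>w\<in>?C. (p i u - p i x) * (p i w - p i x))"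
      by (rule sum.swap)
    also have "\<dots> = (\<Sum>u\<in>?C. \<Sum>w\<in>?C. edge_gram x u w)"
      unfolding edge_gram_def by (intro sum.cong refl sum.swap)
    also have "\<dots> = (\<Sum>u\<in>?C. \<Sum>w\<in>?C. (if u = w then 1 else 0) - n x u * n x w)"
      by (intro sum.cong refl edge_gram_nbrs) auto
    also have "\<dots> = d - s\<^sup>2"
      by (simp add: sum_subtractf sum_product finite_nbrs d_def s_def power2_eq_square)
    finally show ?thesis .
  qed
  have ab: "(\<Sum>i<m. a i * b i) = 1 - n x y * s"
  proof -
    have "(\<Sum>i<m. a i * b i) = (\<Sum>u\<in>?C. edge_gram x u y)"
      unfolding a_def b_def edge_gram_def sum_distrib_right by (rule sum.swap)
    also have "\<dots> = (\<Sum>u\<in>?C. (if u = y then 1 else 0) - n x u * n x y)"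
      by (intro sum.cong refl edge_gram_nbrs) (use y in auto)
    also have "\<dots> = 1 - n x y * s"
      using yz(2) finite_nbrs by (simp add: sum_subtractf s_def sum_distrib_left mult.commute)
    finally show ?thesis .
  qed
  have bb: "(\<Sum>i<m. b i * b i) = 1 - (n x y)\<^sup>2"
    using edge_gram_nbrs[OF y y] by (simp add: edge_gram_def b_def power2_eq_square)
  have "1 - (n y z)\<^sup>2 = (\<Sum>i<m. (p i z - p i y) * (p i z - p i y))"
    using edge_gram_nbrs[OF z(1) z(1)] by (simp add: edge_gram_def power2_eq_square)
  also have "\<dots> = (\<Sum>i<m. k\<^sup>2 * (a i * a i) - 2 * k * (a i * b i) + b i * b i)"
    by (intro sum.cong) (auto simp: pz power2_eq_square algebra_simps)
  also have "\<dots> = (2 / d)\<^sup>2 * (d - s\<^sup>2) - 2 * (2 / d) * (1 - n x y * s) + (1 - (n x y)\<^sup>2)"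
    unfolding sum.distrib sum_subtractf sum_distrib_left[symmetric] aa ab bb k_def ..
  finally have "(n y z)\<^sup>2 = 1 - ((2 / d)\<^sup>2 * (d - s\<^sup>2) - 2 * (2 / d) * (1 - n x y * s) + (1 - (n x y)\<^sup>2))"
    by simp
  also have "\<dots> = (n x y - 2 * s / d)\<^sup>2"
    using d by (simp add: power2_eq_square field_simps)
  finally show "(n y z)\<^sup>2 = (n x y - 2 * normal_sum x z / codegree x z)\<^sup>2" by (simp add: d_def s_def)
  have "- (n y x * n y z) = (\<Sum>i<m. (p i z - p i y) * (p i x - p i y))"
    using edge_gram_nbrs[OF xy z(1)] z(2) by (simp add: edge_gram_def mult.commute)
  also have "\<dots> = (\<Sum>i<m. b i * b i - k * (a i * b i))"
  proof (intro sum.cong refl)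
    fix i assume "i \<in> {..<m}"
    moreover have "p i x - p i y = - b i" by (simp add: b_def)
    ultimately have "(p i z - p i y) * (p i x - p i y) = (k * a i - b i) * (- b i)" using pz by simp
    also have "\<dots> = b i * b i - k * (a i * b i)" by (simp add: algebra_simps)
    finally show "(p i z - p i y) * (p i x - p i y) = b i * b i - k * (a i * b i)" .
  qed
  also have "\<dots> = (1 - (n x y)\<^sup>2) - (2 / d) * (1 - n x y * s)"
    unfolding sum_subtractf sum_distrib_left[symmetric] ab bb k_def ..
  finally have "n y x * n y z = (2 / d) * (1 - n x y * s) - (1 - (n x y)\<^sup>2)" by simp
  also have "\<dots> = n x y * (n x y - 2 * s / d) - (1 - 2 / d)"
    using d by (simp add: power2_eq_square field_simps)
  finally show "n y x * n y z = n x y * (n x y - 2 * normal_sum x z / codegree x z) - (1 - 2 / codegree x z)"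
    by (simp add: d_def s_def)
qed

text \<open>
  Compare the square of \<open>n_two_step_prod\<close> with the product of \<open>n_edge_sym\<close> and
  \<open>n_two_step_sq\<close>: with \<open>q\<close> for the left-hand side and \<open>e = 1 - 2 / d\<close>, where \<open>d\<close> is the codegree, this says
  \<open>(q - e)\<^sup>2 = q\<^sup>2\<close>.
\<close>
lemma common_nbr_quadratic:
  assumes y: "y \<in> N x" and z: "z \<in> N y" "z \<noteq> x" and ne2: "codegree x z \<noteq> 2"
  shows "n x y * (n x y - 2 * normal_sum x z / codegree x z) = 1 / 2 - 1 / codegree x z"
proof -
  define q where "q = n x y * (n x y - 2 * normal_sum x z / codegree x z)"
  define e where "e = 1 - 2 / real (codegree x z)"
  have "q\<^sup>2 = (n x y)\<^sup>2 * (n x y - 2 * normal_sum x z / codegree x z)\<^sup>2" by (simp add: q_def power_mult_distrib)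
  also have "\<dots> = (n y x * n y z)\<^sup>2"
    unfolding n_edge_sym[OF y, symmetric] n_two_step_sq[OF y z, symmetric] by (simp add: power_mult_distrib)
  also have "\<dots> = (q - e)\<^sup>2" unfolding n_two_step_prod[OF y z] q_def e_def ..
  finally have "q\<^sup>2 = (q - e)\<^sup>2" .
  moreover have "e * (e - 2 * q) = (q - e)\<^sup>2 - q\<^sup>2" by (simp add: power2_eq_square algebra_simps)
  ultimately have "e * (e - 2 * q) = 0" by simp
  moreover have "e \<noteq> 0" using ne2 two_step(3)[OF y z] by (simp add: e_def field_simps)
  ultimately have "e - 2 * q = 0" by (metis mult_eq_0_iff)
  then have "q = e / 2" by simp
  then show ?thesis by (simp add: q_def e_def diff_divide_distrib)
qed

text \<open>
  By the Gram matrix, the vector \<open>\<Sum> n u \<cdot> (p u - p x)\<close> has the squared length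
  \<open>|n|\<^sup>2 - |n|\<^sup>4 = 0\<close>.
\<close>
lemma normal_relation:
  assumes x: "x \<in> V" and i: "i < m"
  shows "(\<Sum>u\<in>N x. n x u * (p i u - p i x)) = 0"
proof -
  let ?h = "\<lambda>i. \<Sum>u\<in>N x. n x u * (p i u - p i x)"
  have "(\<Sum>i<m. ?h i * ?h i) = (\<Sum>i<m. \<Sum>u\<in>N x. \<Sum>w\<in>N x. n x u * n x w * ((p i u - p i x) * (p i w - p i x)))"
    by (simp add: sum_product algebra_simps)
  also have "\<dots> = (\<Sum>u\<in>N x. \<Sum>i<m. \<Sum>w\<in>N x. n x u * n x w * ((p i u - p i x) * (p i w - p i x)))"
    by (rule sum.swap)
  also have "\<dots> = (\<Sum>u\<in>N x. \<Sum>w\<in>N x. \<Sum>i<m. n x u * n x w * ((p i u - p i x) * (p i w - p i x)))"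
    by (intro sum.cong refl sum.swap)
  also have "\<dots> = (\<Sum>u\<in>N x. \<Sum>w\<in>N x. (if u = w then (n x u)\<^sup>2 else 0) - (n x u)\<^sup>2 * (n x w)\<^sup>2)"
  proof (intro sum.cong refl)
    fix u w assume "u \<in> N x" "w \<in> N x"
    then show "(\<Sum>i<m. n x u * n x w * ((p i u - p i x) * (p i w - p i x)))
        = (if u = w then (n x u)\<^sup>2 else 0) - (n x u)\<^sup>2 * (n x w)\<^sup>2"
      unfolding sum_distrib_left[symmetric] edge_gram_def[symmetric]
      by (simp add: edge_gram_nbrs power2_eq_square algebra_simps)
  qed
  also have "\<dots> = 0"
    by (simp add: sum_subtractf finite_nbrs unit_n[OF x] sum_distrib_left[symmetric])
  finally have "(\<Sum>i<m. ?h i * ?h i) = 0" .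
  then show ?thesis using i by (simp add: sum_nonneg_eq_0_iff)
qed

text \<open>
  If the path \<open>x, y, z\<close> is the only one of length two between its ends, the two edges at \<open>y\<close> share
  the whole weight of the unit vector \<open>n y\<close>.  Suppose that no continuation \<open>u\<close> of the path has this property
  with respect to \<open>y\<close>.  Then \<open>y\<close> and \<open>u\<close> have a second common neighbour, which carries no weight of
  \<open>n y\<close>.  This forces codegree 2 and no weight of \<open>n z\<close> at \<open>u\<close>, although half of the weight
  of \<open>n z\<close> lies outside of \<open>y\<close>.
\<close>
lemma line_step:
  assumes y: "y \<in> N x" and z: "z \<in> N y" "z \<noteq> x" and one: "codegree x z = 1"
  shows "\<exists>u\<in>N z. u \<noteq> y \<and> codegree y u = 1"
proof (rule ccontr)
  assume "\<not> ?thesis"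
  then have no: "codegree y u \<noteq> 1" if "u \<in> N z" "u \<noteq> y" for u using that by blast
  have C: "N x \<inter> N z = {y}" using two_step(2)[OF y z] one by (metis card_1_singletonE singletonD)
  have y2: "(n x y)\<^sup>2 = 1 / 2" using common_nbr_quadratic[OF y z] one C by (simp add: power2_eq_square)
  have z2: "(n y z)\<^sup>2 = 1 / 2" using n_two_step_sq[OF y z] one C y2 by simp
  have yz2: "(n z y)\<^sup>2 = 1 / 2" using n_edge_sym[OF z(1)] z2 by simp
  have x2: "(n y x)\<^sup>2 = 1 / 2" using n_edge_sym[OF y] y2 by simp
  have xy: "x \<in> N y" using y nbrs_sym by blast
  have zero: "n y w = 0" if w: "w \<in> N y" "w \<noteq> x" "w \<noteq> z" for w
  proof -
    have "1 = (\<Sum>u\<in>N y. (n y u)\<^sup>2)" using unit_n in_V[OF y] by simp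
    also have "\<dots> \<ge> (\<Sum>u\<in>{x, z, w}. (n y u)\<^sup>2)"
      using xy z w finite_nbrs by (intro sum_mono2) auto
    finally show ?thesis using w z x2 z2 by simp
  qed
  have "\<exists>u\<in>N z. u \<noteq> y \<and> n z u \<noteq> 0"
  proof (rule ccontr)
    assume "\<not> ?thesis"
    then have "(\<Sum>u\<in>N z. (n z u)\<^sup>2) = (\<Sum>u\<in>N z. if u = y then 1 / 2 else 0)"
      using yz2 by (intro sum.cong) auto
    also have "\<dots> = 1 / 2" using two_step(2)[OF y z] z(1) nbrs_sym finite_nbrs by auto
    finally show False using unit_n in_V[OF z(1)] by simp
  qed
  then obtain u where u: "u \<in> N z" "u \<noteq> y" "n z u \<noteq> 0" by blast
  have zC: "z \<in> N y \<inter> N u" using two_step(2)[OF z(1) u(1,2)] .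
  then have "N y \<inter> N u \<noteq> {z}" using no[OF u(1,2)] by force
  then obtain y' where y': "y' \<in> N y \<inter> N u" "y' \<noteq> z" using zC by blast
  have "y' \<noteq> x"
  proof
    assume "y' = x"
    then have "u \<in> N x \<inter> N z" using y' u nbrs_sym by blast
    then show False using C u by blast
  qed
  then have ny': "n y y' = 0" using zero y' by blast
  have u': "u \<in> N y'" using y' nbrs_sym by blast
  have two: "codegree y u = 2"
  proof (rule ccontr)
    assume "codegree y u \<noteq> 2"
    then show False using common_nbr_quadratic[of y' y u] y' u' u(2) ny' by auto
  qed
  have "{z, y'} = N y \<inter> N u"
    by (rule card_subset_eq) (use finite_nbrs zC y' two in auto)
  then have "normal_sum y u = n y z" using y'(2) ny' by (metis add.right_neutral empty_iff finite.emptyI insert_iff sum.empty sum.insert finite.insertI)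
  then show False using n_two_step_sq[OF z(1) u(1,2)] u(3) two by simp
qed

text \<open>
  By \<open>line_step\<close> the path would extend indefinitely.  As each vertex is mapped by \<open>p\<close> to the midpoint
  of its two neighbours on the path, some coordinate would grow without bound on a finite graph.
\<close>
lemma common_ne_1:
  assumes y: "y \<in> N x" and z: "z \<in> N y" "z \<noteq> x"
  shows "codegree x z \<noteq> 1"
proof
  assume one: "codegree x z = 1"
  have step: "p i z - p i y = p i y - p i x" if "y \<in> N x" "z \<in> N y" "z \<noteq> x" "codegree x z = 1" "i < m" for x y z i
  proof -
    have "N x \<inter> N z = {y}" using two_step(2)[OF that(1-3)] that(4) by (metis card_1_singletonE singletonD)
    then show ?thesis using two_step_sum[OF that(1-3) that(5)] by simp
  qed
  have "N x \<inter> N z = {y}" using two_step(2)[OF y z] one by (metis card_1_singletonE singletonD)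
  then have "(n x y)\<^sup>2 = 1 / 2" using common_nbr_quadratic[OF y z] one by (simp add: power2_eq_square)
  then have "edge_gram x y y \<noteq> 0" using edge_gram_nbrs[OF y y] by (simp add: power2_eq_square)
  then obtain i where i: "i < m" "p i y - p i x \<noteq> 0"
    unfolding edge_gram_def by (metis (no_types, lifting) lessThan_iff mult_eq_0_iff sum.neutral)
  define c where "c = p i z - p i y"
  have c: "c \<noteq> 0" using step[OF y z one i(1)] i(2) by (simp add: c_def)
  \<comment> \<open>ends of paths with a unique midpoint along which coordinate \<open>i\<close> changes by the same \<open>c\<close>; the one
    farthest in the direction of \<open>c\<close> cannot be continued\<close>
  define S where "S = {z. \<exists>x y. y \<in> N x \<and> z \<in> N y \<and> z \<noteq> x \<and> codegree x z = 1 \<and> p i z - p i y = c}"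
  have "S \<subseteq> V" using in_V by (auto simp: S_def)
  then have fin: "finite ((\<lambda>z. c * p i z) ` S)" using pair_finite_verts finite_subset by blast
  have "z \<in> S" using y z one by (auto simp: S_def c_def)
  then have "Max ((\<lambda>z. c * p i z) ` S) \<in> (\<lambda>z. c * p i z) ` S" using fin by (intro Max_in) auto
  then obtain z' where z': "z' \<in> S" "c * p i z' = Max ((\<lambda>z. c * p i z) ` S)" by auto
  then obtain x' y' where *: "y' \<in> N x'" "z' \<in> N y'" "z' \<noteq> x'" "codegree x' z' = 1" "p i z' - p i y' = c"
    by (auto simp: S_def)
  obtain u where u: "u \<in> N z'" "u \<noteq> y'" "codegree y' u = 1" using line_step[OF *(1-4)] by blast
  have pu: "p i u - p i z' = c" using step[OF *(2) u i(1)] *(5) by simp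
  then have "u \<in> S" using u *(2) by (auto simp: S_def)
  then have "c * p i u \<in> (\<lambda>z. c * p i z) ` S" by blast
  then have "c * p i u \<le> c * p i z'" unfolding z'(2) by (rule Max_ge[OF fin])
  moreover have "c * p i u = c * p i z' + c * c" using pu by (simp add: algebra_simps flip: pu)
  moreover have "c * c > 0" using c by (simp add: zero_less_mult_iff neq_iff) linarith
  ultimately show False by simp
qed

text \<open>
  For codegree \<open>d \<noteq> 2\<close> the components of \<open>n x\<close> at the common neighbours are roots of one
  quadratic polynomial.  Summing that equation over the common neighbours shows \<open>d / 2 - 1 \<le> 1\<close>.  Moreover, the deviations
  from the mean have equal absolute value and sum zero, so \<open>d\<close> is not 3.  For \<open>d = 4\<close> the estimate is an
  equality, which determines \<open>n x\<close> up to signs.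
\<close>
lemma common_cases:
  assumes y: "y \<in> N x" and z: "z \<in> N y" "z \<noteq> x" and ne2: "codegree x z \<noteq> 2"
  shows common_eq_4: "codegree x z = 4" and normal_sum_eq_0: "normal_sum x z = 0"
    and n_common_4: "\<And>w. w \<in> N x \<inter> N z \<Longrightarrow> (n x w)\<^sup>2 = 1 / 4"
    and support_common_4: "\<And>w. w \<in> N x \<Longrightarrow> n x w \<noteq> 0 \<Longrightarrow> w \<in> N x \<inter> N z"
proof -
  let ?C = "N x \<inter> N z"
  define d where "d = real (codegree x z)"
  define s where "s = normal_sum x z"
  have "codegree x z \<ge> 3" using two_step(3)[OF y z] ne2 common_ne_1[OF y z] by linarith
  then have d: "d \<ge> 3" by (simp add: d_def)
  have quad: "n x w * (n x w - 2 * s / d) = 1 / 2 - 1 / d" if "w \<in> ?C" for w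
    using common_nbr_quadratic[of w x z] that z(2) ne2 nbrs_sym by (auto simp: s_def d_def)
  have quad': "(n x w - s / d)\<^sup>2 = 1 / 2 - 1 / d + (s / d)\<^sup>2" if "w \<in> ?C" for w
  proof -
    have "(t - r)\<^sup>2 = t * (t - 2 * r) + r\<^sup>2" for t r :: real by (simp add: power2_eq_square algebra_simps)
    from this[of "n x w" "s / d"] show ?thesis using quad[OF that] by simp
  qed
  have "(\<Sum>w\<in>?C. n x w * (n x w - 2 * s / d)) = (\<Sum>w\<in>?C. 1 / 2 - 1 / d)"
    by (intro sum.cong refl quad)
  moreover have "(\<Sum>w\<in>?C. n x w * (n x w - r)) = (\<Sum>w\<in>?C. (n x w)\<^sup>2) - r * s" for r
    by (simp add: s_def right_diff_distrib sum_subtractf sum_distrib_left power2_eq_square mult.commute)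
  ultimately have "(\<Sum>w\<in>?C. (n x w)\<^sup>2) - 2 * s / d * s = d * (1 / 2 - 1 / d)"
    by (simp add: d_def)
  then have sq: "(\<Sum>w\<in>?C. (n x w)\<^sup>2) = d / 2 - 1 + 2 * (s * s / d)"
    using d by (simp add: right_diff_distrib)
  have "(\<Sum>w\<in>?C. (n x w)\<^sup>2) \<le> (\<Sum>w\<in>N x. (n x w)\<^sup>2)"
    using finite_nbrs by (intro sum_mono2) auto
  then have le1: "d / 2 - 1 + 2 * (s * s / d) \<le> 1" using unit_n in_V[OF y] sq by simp
  have ssd: "s * s / d \<ge> 0" using d by simp
  then have "d \<le> 4" using le1 by linarith
  have "codegree x z \<noteq> 3"
  proof
    assume three: "codegree x z = 3"
    then obtain a b c where C: "?C = {a, b, c}" "a \<noteq> b" "b \<noteq> c" "a \<noteq> c"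
      unfolding card_3_iff by blast
    let ?t = "\<lambda>w. n x w - s / d"
    have "s = n x a + n x b + n x c" unfolding s_def C(1) using C by simp
    then have sum: "?t a + ?t b + ?t c = 0" using three by (simp add: d_def field_simps)
    have eq: "(?t a)\<^sup>2 = (?t b)\<^sup>2" "(?t b)\<^sup>2 = (?t c)\<^sup>2" using quad' C(1) by auto
    then have "?t a = 0" using sum by (auto simp: power2_eq_iff)
    then have "1 / 2 - 1 / d + (s / d)\<^sup>2 = 0" using quad'[of a] C(1) by simp
    moreover have "(s / d)\<^sup>2 \<ge> 0" "1 / 2 - 1 / d > 0" using d by (auto simp: field_simps)
    ultimately show False by linarith
  qed
  then show four: "codegree x z = 4" using \<open>codegree x z \<ge> 3\<close> \<open>d \<le> 4\<close> by (simp add: d_def)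
  then have d4: "d = 4" by (simp add: d_def)
  then have "s * s \<le> 0" using le1 by simp
  then have s0: "s = 0" by (meson antisym mult_eq_0_iff zero_le_square)
  then show "normal_sum x z = 0" by (simp add: s_def)
  show "(n x w)\<^sup>2 = 1 / 4" if "w \<in> ?C" for w using quad[OF that] d4 s0 by (simp add: power2_eq_square)
  show "w \<in> ?C" if w: "w \<in> N x" "n x w \<noteq> 0" for w
  proof (rule ccontr)
    assume "w \<notin> ?C"
    then have "(n x w)\<^sup>2 + (\<Sum>u\<in>?C. (n x u)\<^sup>2) = (\<Sum>u\<in>insert w ?C. (n x u)\<^sup>2)"
      using finite_nbrs by simp
    also have "\<dots> \<le> (\<Sum>u\<in>N x. (n x u)\<^sup>2)" using w finite_nbrs by (intro sum_mono2) auto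
    also have "\<dots> = 1" using unit_n in_V[OF y] by simp
    finally show False using sq d4 s0 w(2) by simp
  qed
qed

text \<open>
  Otherwise \<open>x\<close> and \<open>z\<close> have four common neighbours, at which \<open>n x\<close> is \<open>1/2\<close> (at \<open>a\<close>, \<open>b\<close>)
  or \<open>-1/2\<close> (at \<open>c\<close>, \<open>e\<close>).  The pairs \<open>a, c\<close> and \<open>a, e\<close> also have codegree 4, since codegree 2 would
  make \<open>p\<close> equal at two common neighbours.  Their common neighbours form the support of \<open>n a\<close> in both
  cases.  A member \<open>u\<close> of it other than \<open>x\<close> and \<open>z\<close> then has the same common neighbours with
  \<open>x\<close> as \<open>z\<close> has, which implies \<open>p u = p z\<close> and contradicts the Gram matrix at \<open>a\<close>.
\<close>
lemma common_two:
  assumes y: "y \<in> N x" and z: "z \<in> N y" "z \<noteq> x"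
  shows "codegree x z = 2"
proof (rule ccontr)
  assume ne2: "codegree x z \<noteq> 2"
  let ?C = "N x \<inter> N z"
  note four = common_cases[OF y z ne2]
  have half: "n x w = 1 / 2 \<or> n x w = - 1 / 2" if "w \<in> ?C" for w
    using four(3)[OF that] power2_eq_iff[of "n x w" "1 / 2"] by (simp add: power2_eq_square)
  let ?P = "{w \<in> ?C. n x w = 1 / 2}" and ?M = "{w \<in> ?C. n x w = - 1 / 2}"
  have CPM: "?C = ?P \<union> ?M" "?P \<inter> ?M = {}" using half by auto
  have fin: "finite ?P" "finite ?M" using finite_nbrs by auto
  have "codegree x z = card (?P \<union> ?M)" by (rule arg_cong[OF CPM(1)])
  then have "card ?P + card ?M = 4" using card_Un_disjoint[OF fin CPM(2)] four(1) by linarith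
  moreover have "real (card ?P) = real (card ?M)"
  proof -
    have "0 = normal_sum x z" using four(2) by simp
    also have "\<dots> = (\<Sum>w\<in>?P \<union> ?M. n x w)" by (rule sum.cong[OF CPM(1) refl])
    also have "\<dots> = (\<Sum>w\<in>?P. n x w) + (\<Sum>w\<in>?M. n x w)" by (rule sum.union_disjoint[OF fin CPM(2)])
    also have "\<dots> = (\<Sum>w\<in>?P. 1 / 2) + (\<Sum>w\<in>?M. - 1 / 2)" by (intro arg_cong2[of _ _ _ _ "(+)"] sum.cong) auto
    finally show ?thesis by simp
  qed
  ultimately have "card ?P = 2" "card ?M = 2" by simp_all
  then obtain a b c e where ab: "?P = {a, b}" "a \<noteq> b" and ce: "?M = {c, e}" "c \<noteq> e"
    by (auto simp: card_2_iff)
  have C: "?C = {a, b, c, e}" using CPM(1) ab ce by auto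
  have na: "n x a = 1 / 2" "n x b = 1 / 2" using ab by auto
  have nc: "n x c = - 1 / 2" "n x e = - 1 / 2" using ce by auto
  have dist: "a \<noteq> c" "a \<noteq> e" "b \<noteq> c" "b \<noteq> e" using na nc by auto
  have nb: "a \<in> N x" "b \<in> N x" "c \<in> N x" "e \<in> N x" "a \<in> N z" "c \<in> N z" "e \<in> N z" using C by auto
  have x: "x \<in> N a" "z \<in> N a" "x \<in> N c" "z \<in> N c" "x \<in> N e" "z \<in> N e" using nb nbrs_sym by blast+
  have "x \<in> V" using in_V y by blast
  have pab: "p i a + p i b = p i c + p i e" if i: "i < m" for i
  proof -
    have "0 = (\<Sum>u\<in>N x. n x u * (p i u - p i x))" using normal_relation[OF \<open>x \<in> V\<close> i] by simp
    also have "\<dots> = (\<Sum>u\<in>?C. n x u * (p i u - p i x))"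
      by (rule sum.mono_neutral_right) (use finite_nbrs four(4) in auto)
    also have "\<dots> = n x a * (p i a - p i x) + n x b * (p i b - p i x) + n x c * (p i c - p i x) + n x e * (p i e - p i x)"
      unfolding C using ab(2) ce(2) dist by simp
    also have "\<dots> = (p i a + p i b - p i c - p i e) / 2"
      unfolding na nc by (simp add: field_simps)
    finally show ?thesis by simp
  qed
  have pxz: "p i x + p i z = p i a + p i b" if i: "i < m" for i
    using two_step_sum[OF y z i] unfolding four(1) using ab(2) ce(2) dist pab[OF i] unfolding C by simp
  have cd4: "codegree a w = 4 \<and> (\<forall>u\<in>N a \<inter> N w. (n a u)\<^sup>2 = 1 / 4) \<and> N a \<inter> N w = {u \<in> N a. n a u \<noteq> 0}"
    if w: "w \<in> {c, e}" for w
  proof -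
    have w': "w \<in> N x" "w \<noteq> a" "x \<in> N w" "z \<in> N w" "w \<noteq> b" using w nb x dist by auto
    have "codegree a w \<noteq> 2"
    proof
      assume two: "codegree a w = 2"
      have "{x, z} = N a \<inter> N w"
        by (rule card_subset_eq) (use finite_nbrs x w' two z(2) in auto)
      then have "p i w + p i a = p i x + p i z" if "i < m" for i
        using two_step_sum[OF x(1) w'(1,2) that] two z(2) by (metis (no_types, lifting) empty_iff finite.emptyI finite.insertI insert_iff mult_cancel_left of_nat_numeral sum.empty sum.insert zero_neq_numeral add.right_neutral)
      then have "p i w = p i b" if "i < m" for i using pxz that by fastforce
      then have "edge_gram x b w = edge_gram x b b" by (simp add: edge_gram_def)
      moreover have "n x w = - 1 / 2" using w nc by auto
      ultimately show False using edge_gram_nbrs[OF nb(2) w'(1)] edge_gram_nbrs[OF nb(2) nb(2)] w'(5) na by simp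
    qed
    note c4 = common_cases[OF x(1) w'(1,2) this]
    have "N a \<inter> N w = {u \<in> N a. n a u \<noteq> 0}"
    proof (intro set_eqI iffI)
      fix u assume "u \<in> N a \<inter> N w"
      then show "u \<in> {u \<in> N a. n a u \<noteq> 0}" using c4(3)[of u] by auto
    qed (use c4(4) in blast)
    then show ?thesis using c4(1,3) by blast
  qed
  have eq: "N a \<inter> N c = N a \<inter> N e" using cd4 by blast
  have "\<not> N a \<inter> N c \<subseteq> {x, z}"
  proof
    assume "N a \<inter> N c \<subseteq> {x, z}"
    then have "card (N a \<inter> N c) \<le> card {x, z}" by (intro card_mono) auto
    also have "\<dots> \<le> 2" by (simp add: card_insert_if)
    finally have "codegree a c \<le> 2" .
    moreover have "codegree a c = 4" using cd4[of c] by blast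
    ultimately show False by linarith
  qed
  then obtain u where u: "u \<in> N a \<inter> N c" "u \<noteq> x" "u \<noteq> z" by blast
  then have ue: "a \<in> N u" "c \<in> N u" "e \<in> N u" "u \<in> N a" using eq nbrs_sym by blast+
  have "codegree x u \<noteq> 2"
  proof
    assume "codegree x u = 2"
    moreover have "card {a, c, e} \<le> codegree x u" by (rule card_mono) (use finite_nbrs nb ue in auto)
    ultimately show False using dist ce(2) by simp
  qed
  note u4 = common_cases[OF nb(1) ue(4) u(2) this]
  have "N x \<inter> N u = ?C"
  proof (intro set_eqI iffI)
    fix w assume w: "w \<in> N x \<inter> N u"
    show "w \<in> ?C" by (rule four(4)) (use u4(3)[OF w] w in auto)
  next
    fix w assume w: "w \<in> ?C"
    show "w \<in> N x \<inter> N u" by (rule u4(4)) (use four(3)[OF w] w in auto)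
  qed
  then have "p i u = p i z" if "i < m" for i
    using two_step_sum[OF nb(1) ue(4) u(2) that] two_step_sum[OF y z that] four(1) by simp
  then have "edge_gram a u z = edge_gram a u u" by (simp add: edge_gram_def)
  moreover have "z \<in> N a \<inter> N c" using x by blast
  then have "(n a u)\<^sup>2 = 1 / 4" "(n a z)\<^sup>2 = 1 / 4" using cd4[of c] u by auto
  moreover have "edge_gram a u z = - (n a u * n a z)" "edge_gram a u u = 1 - (n a u)\<^sup>2"
    using edge_gram_nbrs[OF ue(4) x(2)] edge_gram_nbrs[OF ue(4) ue(4)] u(3) by (simp_all add: power2_eq_square)
  ultimately have prod: "n a u * n a z = - 3 / 4" and sq: "(n a u)\<^sup>2 = 1 / 4" "(n a z)\<^sup>2 = 1 / 4"
    by simp_all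
  have "(n a u * n a z)\<^sup>2 = 1 / 4 * (1 / 4)" unfolding power_mult_distrib sq ..
  then have "(- 3 / 4)\<^sup>2 = (1 / 16 :: real)" unfolding prod by simp
  then show False by (simp add: power2_eq_square)
qed

end

section \<open>Recognising the hypercube\<close>

lemma digraph_isoI:
  fixes G :: "'a pair_pre_digraph" and H :: "'b pair_pre_digraph"
  assumes wf: "pair_wf_digraph H" and h: "bij_betw h (pverts H) (pverts G)"
    and wfG: "pair_wf_digraph G"
    and adj: "\<And>u v. u \<in> pverts H \<Longrightarrow> v \<in> pverts H \<Longrightarrow> (u, v) \<in> parcs H \<longleftrightarrow> (h u, h v) \<in> parcs G"
  shows "digraph_iso (with_proj H) (with_proj G)"
proof -
  interpret H: pair_wf_digraph H by (rule wf)
  interpret G: pair_wf_digraph G by (rule wfG)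
  have inj: "inj_on h (pverts H)" and im: "h ` pverts H = pverts G" using h by (auto simp: bij_betw_def)
  have arcs: "parcs H \<subseteq> pverts H \<times> pverts H" by (auto dest: H.in_arcsD1 H.in_arcsD2)
  have "inj_on (map_prod h h) (parcs H)"
    by (rule inj_on_subset[OF map_prod_inj_on[OF inj inj] arcs])
  moreover have "map_prod h h ` parcs H = parcs G"
  proof
    show "map_prod h h ` parcs H \<subseteq> parcs G" using adj arcs by auto
    show "parcs G \<subseteq> map_prod h h ` parcs H"
    proof
      fix a assume a: "a \<in> parcs G"
      then have "fst a \<in> h ` pverts H" "snd a \<in> h ` pverts H"
        using G.arc_fst_in_verts G.arc_snd_in_verts im by auto
      then obtain u v where uv: "u \<in> pverts H" "v \<in> pverts H" "a = (h u, h v)" by (metis imageE prod.collapse)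
      then have "(u, v) \<in> parcs H" using adj a by blast
      then show "a \<in> map_prod h h ` parcs H" using uv(3) by force
    qed
  qed
  moreover define f :: "('b, 'b \<times> 'b, 'a, 'a \<times> 'a) digraph_isomorphism" where
    "f = \<lparr>iso_verts = h, iso_arcs = map_prod h h, iso_head = snd, iso_tail = fst\<rparr>"
  ultimately have "pre_digraph.digraph_isomorphism (with_proj H) f"
    unfolding pre_digraph.digraph_isomorphism_def using inj H.wf_digraph by (simp add: f_def)
  moreover have "with_proj G = app_iso f (with_proj H)"
    unfolding app_iso_def using im \<open>map_prod h h ` parcs H = parcs G\<close>
    by (simp add: f_def with_proj_def[of G])
  ultimately show ?thesis unfolding digraph_iso_def by blast
qed

definition toggle :: "nat \<Rightarrow> nat set \<Rightarrow> nat set" where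
  "toggle i S = (if i \<in> S then S - {i} else insert i S)"

lemma toggle_toggle [simp]: "toggle i (toggle i S) = S"
  by (auto simp: toggle_def)

lemma in_toggle_iff: "k \<in> toggle i S \<longleftrightarrow> (if k = i then k \<notin> S else k \<in> S)"
  by (auto simp: toggle_def)

lemma finite_toggle [simp]: "finite (toggle i S) \<longleftrightarrow> finite S"
  by (simp add: toggle_def)

lemma toggle_subset: "S \<subseteq> {..<D} \<Longrightarrow> i < D \<Longrightarrow> toggle i S \<subseteq> {..<D}"
  by (auto simp: toggle_def)

text \<open>
  A vector over the field with two elements corresponds to the set of coordinates where it is 1.
\<close>
lemma hypercube_digraph_isoI:
  assumes G: "pair_graph G"
    and bij: "bij_betw \<psi> (Pow {..<D}) (pverts G)"
    and nb: "\<And>S. S \<subseteq> {..<D} \<Longrightarrow> nbrs G (\<psi> S) = (\<lambda>i. \<psi> (toggle i S)) ` {..<D}"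
  shows "digraph_iso (with_proj G) (with_proj (hypercube D))"
proof -
  interpret G: pair_graph G by (rule G)
  define S where "S u = {i. i < D \<and> u i = (1 :: bit)}" for u
  have wf: "pair_wf_digraph (hypercube D)"
  proof
    fix e assume "e \<in> parcs (hypercube D)"
    then show "fst e \<in> pverts (hypercube D)" "snd e \<in> pverts (hypercube D)"
      unfolding hypercube_def pair_pre_digraph.simps by (clarify, simp only: fst_conv snd_conv)+
  qed
  interpret H: pair_wf_digraph "hypercube D" by (rule wf)
  have S_sub: "S u \<subseteq> {..<D}" for u by (auto simp: S_def)
  have bijS: "bij_betw S ({..<D} \<rightarrow>\<^sub>E UNIV) (Pow {..<D})"
  proof (rule bij_betwI')
    fix u v :: "nat \<Rightarrow> bit" assume uv: "u \<in> {..<D} \<rightarrow>\<^sub>E UNIV" "v \<in> {..<D} \<rightarrow>\<^sub>E UNIV"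
    show "S u = S v \<longleftrightarrow> u = v"
    proof
      assume eq: "S u = S v"
      show "u = v"
      proof (rule PiE_ext[OF uv])
        fix i assume "i \<in> {..<D}"
        then have "u i = 1 \<longleftrightarrow> v i = 1" using eq by (auto simp: S_def)
        then show "u i = v i" by (metis bit_not_one_iff)
      qed
    qed simp
  next
    fix T assume T: "T \<in> Pow {..<D}"
    show "\<exists>u\<in>{..<D} \<rightarrow>\<^sub>E UNIV. T = S u"
      by (rule bexI[of _ "\<lambda>i\<in>{..<D}. if i \<in> T then 1 else 0"]) (use T in \<open>auto simp: S_def\<close>)
  qed (use S_sub in auto)
  have "digraph_iso (with_proj (hypercube D)) (with_proj G)"
  proof (rule digraph_isoI[OF wf _ G.pair_wf_digraph])
    show "bij_betw (\<psi> \<circ> S) (pverts (hypercube D)) (pverts G)"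
      using bij_betw_trans[OF bijS bij] by (simp add: hypercube_def)
    fix u v assume uv: "u \<in> pverts (hypercube D)" "v \<in> pverts (hypercube D)"
    have diff: "{i. i < D \<and> u i \<noteq> v i} = {i. i \<in> S u \<longleftrightarrow> i \<notin> S v}"
      by (auto simp: S_def)
    have "card {i. i < D \<and> u i \<noteq> v i} = 1 \<longleftrightarrow> (\<exists>i<D. S v = toggle i (S u))"
    proof
      assume "card {i. i < D \<and> u i \<noteq> v i} = 1"
      then obtain i where i: "{i. i < D \<and> u i \<noteq> v i} = {i}" by (auto simp: card_1_singleton_iff)
      then have "i < D" by blast
      moreover have "S v = toggle i (S u)"
        using i unfolding diff by (auto simp: in_toggle_iff set_eq_iff)
      ultimately show "\<exists>i<D. S v = toggle i (S u)" by blast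
    next
      assume "\<exists>i<D. S v = toggle i (S u)"
      then obtain i where "i < D" "S v = toggle i (S u)" by blast
      then have "{i. i < D \<and> u i \<noteq> v i} = {i}" unfolding diff by (auto simp: in_toggle_iff)
      then show "card {i. i < D \<and> u i \<noteq> v i} = 1" by simp
    qed
    also have "\<dots> \<longleftrightarrow> \<psi> (S v) \<in> nbrs G (\<psi> (S u))"
    proof -
      have "\<psi> (S v) = \<psi> (toggle i (S u)) \<longleftrightarrow> S v = toggle i (S u)" if "i < D" for i
        by (rule inj_on_eq_iff[OF bij_betw_imp_inj_on[OF bij]]) (simp_all add: S_sub toggle_subset[OF S_sub that])
      then show ?thesis unfolding nb[OF S_sub] by auto
    qed
    finally show "(u, v) \<in> parcs (hypercube D) \<longleftrightarrow> ((\<psi> \<circ> S) u, (\<psi> \<circ> S) v) \<in> parcs G"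
      using uv by (simp add: hypercube_def nbrs_def)
  qed
  then show ?thesis by (rule digraph_iso_swap[OF H.wf_digraph])
qed

section \<open>Parallel transport of frames\<close>

context isometric_eigenmap
begin

text \<open>The fourth corner of the square on the edges from \<open>x\<close> to \<open>y\<close> and to \<open>w\<close>.\<close>
definition opposite :: "'a \<Rightarrow> 'a \<Rightarrow> 'a \<Rightarrow> 'a" where
  "opposite x y w = (THE z. z \<in> N y \<inter> N w - {x})"

lemma opposite_unique:
  assumes y: "y \<in> N x" and w: "w \<in> N x" "w \<noteq> y"
  shows "N y \<inter> N w = {x, opposite x y w}" "opposite x y w \<noteq> x"
proof -
  have xy: "x \<in> N y" using y nbrs_sym by blast
  have x: "x \<in> N y \<inter> N w" using y w nbrs_sym by blast
  have "card (N y \<inter> N w) = 2" using common_two[OF xy w] .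
  then have "card (N y \<inter> N w - {x}) = 1" using x finite_nbrs by simp
  then obtain z where z: "N y \<inter> N w - {x} = {z}" by (auto simp: card_1_singleton_iff)
  then have "opposite x y w = z" unfolding opposite_def by auto
  then show "N y \<inter> N w = {x, opposite x y w}" "opposite x y w \<noteq> x" using z x by auto
qed

lemma oppositeI: "\<lbrakk>y \<in> N x; w \<in> N x; w \<noteq> y; z \<in> N y; z \<in> N w; z \<noteq> x\<rbrakk> \<Longrightarrow> opposite x y w = z"
  using opposite_unique(1)[of y x w] by blast

lemma opposite_nbrs:
  assumes "y \<in> N x" "w \<in> N x" "w \<noteq> y"
  shows "opposite x y w \<in> N y" "opposite x y w \<in> N w" "y \<in> N (opposite x y w)" "w \<in> N (opposite x y w)" "opposite x y w \<noteq> x"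
  using opposite_unique[OF assms] nbrs_sym by blast+

lemma opposite_commute: "opposite x y w = opposite x w y"
  by (simp add: opposite_def Int_commute)

text \<open>
  For codegree 2 the identity at distance two is the parallelogram law.
\<close>
lemma p_opposite:
  assumes "y \<in> N x" "w \<in> N x" "w \<noteq> y" "i < m"
  shows "p i (opposite x y w) = p i y + p i w - p i x"
proof -
  have xy: "x \<in> N y" using assms nbrs_sym by blast
  show ?thesis
    using two_step_sum[OF xy assms(2-4)] common_two[OF xy assms(2,3)] opposite_unique[OF assms(1-3)] by simp
qed

text \<open>
  A further neighbour would raise the codegree of \<open>x\<close> and the opposite corner to 3.
\<close>
lemma opposite_not_nbr:
  assumes "y \<in> N x" "w \<in> N x" "w \<noteq> y" "u \<in> N x" "u \<noteq> y" "u \<noteq> w"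
  shows "opposite x y w \<notin> N u"
proof
  note o = opposite_nbrs[OF assms(1-3)]
  assume "opposite x y w \<in> N u"
  then have "{y, w, u} \<subseteq> N x \<inter> N (opposite x y w)" using assms o nbrs_sym by blast
  then have "card {y, w, u} \<le> codegree x (opposite x y w)" by (rule card_mono[rotated]) (simp add: finite_nbrs)
  then show False using common_two[OF assms(1) o(1,5)] assms by simp
qed

text \<open>
  The two candidates \<open>w\<^sub>a\<close> and \<open>w\<^sub>b\<close> for the last corner of the cube are neighbours of \<open>z\<close>, the corner opposite to
  \<open>x\<close> in the square on \<open>a\<close> and \<open>b\<close>, and they have the same image under \<open>p\<close>.  If they differ, the
  Gram matrix at \<open>z\<close> shows that \<open>n z\<close> is supported on them.  So their edge vectors, which are translates of the
  one from \<open>x\<close> to \<open>c\<close>, have squared length \<open>1/2\<close>, and all other edge vectors at \<open>z\<close> are unit vectors.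
\<close>
lemma cube_defect:
  assumes nb: "a \<in> N x" "b \<in> N x" "c \<in> N x" and ne: "a \<noteq> b" "a \<noteq> c" "b \<noteq> c"
    and defect: "opposite a (opposite x a b) (opposite x a c) \<noteq> opposite b (opposite x a b) (opposite x b c)"
  shows "edge_gram x c c = 1 / 2" "edge_gram x a a = 1" "edge_gram x b b = 1"
proof -
  define z zac zbc where "z = opposite x a b" and "zac = opposite x a c" and "zbc = opposite x b c"
  note ab = opposite_nbrs[OF nb(1,2) ne(1)[symmetric], folded z_def]
  note ac = opposite_nbrs[OF nb(1,3) ne(2)[symmetric], folded zac_def]
  note bc = opposite_nbrs[OF nb(2,3) ne(3)[symmetric], folded zbc_def]
  have "zac \<notin> N b" "zbc \<notin> N a"
    unfolding zac_def zbc_def by (rule opposite_not_nbr; use nb ne in simp)+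
  then have zz: "zac \<noteq> z" "zbc \<noteq> z" "a \<notin> N zbc" "b \<notin> N zac" using ab nbrs_sym by auto
  define wa wb where "wa = opposite a z zac" and "wb = opposite b z zbc"
  note wa = opposite_nbrs[OF ab(1) ac(1) zz(1), folded wa_def]
  note wb = opposite_nbrs[OF ab(2) bc(1) zz(2), folded wb_def]
  have ne': "wa \<noteq> wb" using defect by (simp add: wa_def wb_def z_def zac_def zbc_def)
  have abw: "a \<noteq> wa" "a \<noteq> wb" "b \<noteq> wa" "b \<noteq> wb" using wa wb zz by auto
  have pz: "p i z = p i a + p i b - p i x" if "i < m" for i
    using p_opposite[OF nb(1,2) ne(1)[symmetric] that] by (simp add: z_def)
  have pwa: "p i wa = p i z + p i c - p i x" if "i < m" for i
    using p_opposite[OF ab(1) ac(1) zz(1) that] p_opposite[OF nb(1,3) ne(2)[symmetric] that]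
    by (simp add: wa_def zac_def)
  have pwb: "p i wb = p i z + p i c - p i x" if "i < m" for i
    using p_opposite[OF ab(2) bc(1) zz(2) that] p_opposite[OF nb(2,3) ne(3)[symmetric] that]
    by (simp add: wb_def zbc_def)
  have gram_w: "edge_gram z wa wa = edge_gram x c c" "edge_gram z wa wb = edge_gram x c c" "edge_gram z wb wb = edge_gram x c c"
    unfolding edge_gram_def by (intro sum.cong; simp add: pwa pwb)+
  have eqs: "1 - (n z wa)\<^sup>2 = edge_gram x c c" "1 - (n z wb)\<^sup>2 = edge_gram x c c" "- (n z wa * n z wb) = edge_gram x c c"
    using edge_gram_nbrs[OF wa(1) wa(1)] edge_gram_nbrs[OF wb(1) wb(1)] edge_gram_nbrs[OF wa(1) wb(1)] ne' gram_w
    by (simp_all add: power2_eq_square)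
  have "(n z wa)\<^sup>2 = (n z wb)\<^sup>2" using eqs by simp
  then have "n z wa = n z wb \<or> n z wa = - n z wb" by (simp add: power2_eq_iff)
  then have "n z wa = - n z wb" using eqs by (auto simp: power2_eq_square)
  then have half: "(n z wa)\<^sup>2 = 1 / 2" "(n z wb)\<^sup>2 = 1 / 2" using eqs by (auto simp: power2_eq_square)
  then show "edge_gram x c c = 1 / 2" using eqs by simp
  have zero: "n z u = 0" if u: "u \<in> N z" "u \<noteq> wa" "u \<noteq> wb" for u
  proof -
    have "(\<Sum>w\<in>{wa, wb, u}. (n z w)\<^sup>2) \<le> (\<Sum>w\<in>N z. (n z w)\<^sup>2)"
      using finite_nbrs wa wb u by (intro sum_mono2) auto
    then show ?thesis using unit_n in_V[OF u(1)] half u ne' by simp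
  qed
  have "edge_gram z b b = edge_gram x a a" "edge_gram z a a = edge_gram x b b"
    unfolding edge_gram_def by (intro sum.cong; simp add: pz algebra_simps)+
  then show "edge_gram x a a = 1" "edge_gram x b b = 1"
    using edge_gram_nbrs[OF ab(4) ab(4)] edge_gram_nbrs[OF ab(3) ab(3)] zero[OF ab(4)] zero[OF ab(3)] abw by simp_all
qed

text \<open>
  A defect between two of the three candidates for the last corner is incompatible with a defect
  between another two, because the lengths in \<open>cube_defect\<close> disagree.  So two of the three pairs coincide,
  hence all three.
\<close>
lemma cube:
  assumes nb: "a \<in> N x" "b \<in> N x" "c \<in> N x" and ne: "a \<noteq> b" "a \<noteq> c" "b \<noteq> c"
  shows "opposite a (opposite x a b) (opposite x a c) = opposite b (opposite x a b) (opposite x b c)"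
proof (rule ccontr)
  assume neq: "\<not> ?thesis"
  note defect = cube_defect[OF nb ne neq]
  have "opposite b (opposite x b c) (opposite x b a) = opposite c (opposite x b c) (opposite x c a)"
    using cube_defect(1)[OF nb(2,3,1)] ne defect(2) by fastforce
  moreover have "opposite a (opposite x a c) (opposite x a b) = opposite c (opposite x a c) (opposite x c b)"
    using cube_defect(1)[OF nb(1,3,2)] ne defect(3) by fastforce
  ultimately show False using neq by (metis opposite_commute)
qed

text \<open>A vertex together with a labelling of its edges by \<open>{..m}\<close>.\<close>
definition frame :: "'a \<times> (nat \<Rightarrow> 'a) \<Rightarrow> bool" where
  "frame F \<longleftrightarrow> fst F \<in> V \<and> bij_betw (snd F) {..m} (N (fst F))"

text \<open>
  Move along the edge with label \<open>i\<close> and transport the other labels across the squares on that edge.  The traversed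
  edge keeps its label, and labels above \<open>m\<close> as well as pairs that are no frames remain unchanged, so that flips are
  commuting involutions on the whole type.
\<close>
definition flip :: "nat \<Rightarrow> 'a \<times> (nat \<Rightarrow> 'a) \<Rightarrow> 'a \<times> (nat \<Rightarrow> 'a)" where
  "flip i F = (if frame F \<and> i \<le> m
     then (snd F i, \<lambda>j. if j = i then fst F else if j \<le> m then opposite (fst F) (snd F i) (snd F j) else snd F j)
     else F)"

lemma frameD:
  assumes "frame (x, e)"
  shows "x \<in> V" "i \<le> m \<Longrightarrow> e i \<in> N x" "i \<le> m \<Longrightarrow> j \<le> m \<Longrightarrow> e i = e j \<longleftrightarrow> i = j"
  using assms by (auto simp: frame_def bij_betw_def inj_on_eq_iff)

lemma flip_eq:
  assumes "frame (x, e)" "i \<le> m"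
  shows "flip i (x, e) = (e i, \<lambda>j. if j = i then x else if j \<le> m then opposite x (e i) (e j) else e j)"
  using assms by (auto simp: flip_def fun_eq_iff)

text \<open>
  Distinct labels stay distinct: a vertex opposite to \<open>x\<close> is adjacent to just two neighbours
  of \<open>x\<close>.
\<close>
lemma frame_flip:
  assumes F: "frame F"
  shows "frame (flip i F)"
proof (cases "i \<le> m")
  case i: True
  obtain x e where Fe: "F = (x, e)" by fastforce
  note e = frameD[OF F[unfolded Fe]]
  define e' where "e' = (\<lambda>j. if j = i then x else if j \<le> m then opposite x (e i) (e j) else e j)"
  have xe: "x \<in> N (e i)" using e(2)[OF i] nbrs_sym by blast
  have o: "opposite x (e i) (e j) \<in> N (e i)" "opposite x (e i) (e j) \<in> N (e j)" "opposite x (e i) (e j) \<noteq> x"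
    if "j \<le> m" "j \<noteq> i" for j
    using opposite_nbrs[OF e(2)[OF i] e(2)[OF that(1)]] e(3)[OF i that(1)] that(2) by metis+
  have "e' ` {..m} \<subseteq> N (e i)" using xe o by (auto simp: e'_def)
  moreover have "inj_on e' {..m}"
  proof (rule inj_onI)
    fix j k assume jk: "j \<in> {..m}" "k \<in> {..m}" "e' j = e' k"
    show "j = k"
    proof (rule ccontr)
      assume ne: "j \<noteq> k"
      show False
      proof (cases "j = i \<or> k = i")
        case True
        then show ?thesis using jk ne o[of j] o[of k] by (auto simp: e'_def)
      next
        case False
        then have "opposite x (e i) (e j) \<in> N (e k)" using jk o[of k] by (auto simp: e'_def)
        then show ?thesis using opposite_not_nbr[of "e i" x "e j" "e k"] e i jk ne False by auto
      qed
    qed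
  qed
  moreover have "card (N (e i)) = card {..m}" using regular in_V[OF xe] by simp
  ultimately have "bij_betw e' {..m} (N (e i))"
    unfolding bij_betw_def using card_subset_eq[OF finite_nbrs] card_image by metis
  then show ?thesis
    using in_V[OF xe] by (simp add: Fe flip_eq[OF F[unfolded Fe] i] frame_def e'_def)
qed (simp add: flip_def F)

lemma flip_flip: "flip i (flip i F) = F"
proof (cases "frame F \<and> i \<le> m")
  case True
  obtain x e where Fe: "F = (x, e)" by fastforce
  have F: "frame (x, e)" and i: "i \<le> m" using True Fe by auto
  note e = frameD[OF F]
  have F': "frame (e i, \<lambda>j. if j = i then x else if j \<le> m then opposite x (e i) (e j) else e j)"
    using frame_flip[OF F, of i] by (simp add: flip_eq[OF F i])
  have "opposite (e i) x (opposite x (e i) (e j)) = e j" if "j \<le> m" "j \<noteq> i" for j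
  proof -
    have ej: "e j \<in> N x" "e j \<noteq> e i" using e i that by auto
    note o = opposite_nbrs[OF e(2)[OF i] ej]
    show ?thesis
      by (rule oppositeI) (use o ej e(2)[OF i] nbrs_sym in blast)+
  qed
  then show ?thesis
    unfolding Fe flip_eq[OF F i] flip_eq[OF F' i] by (auto simp: fun_eq_iff)
qed (auto simp: flip_def)

text \<open>
  Two flips lead to the opposite corner of a square; any third label moves to the last corner of a
  cube.
\<close>
lemma flip_flip_eq:
  assumes F: "frame (x, e)" and ij: "i \<le> m" "j \<le> m" "i \<noteq> j"
  shows "flip j (flip i (x, e)) = (opposite x (e i) (e j),
     \<lambda>k. if k = j then e i else if k = i then e j
         else if k \<le> m then opposite (e i) (opposite x (e i) (e j)) (opposite x (e i) (e k)) else e k)"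
proof -
  note e = frameD[OF F]
  let ?e' = "\<lambda>j. if j = i then x else if j \<le> m then opposite x (e i) (e j) else e j"
  have F': "frame (e i, ?e')" using frame_flip[OF F, of i] by (simp add: flip_eq[OF F ij(1)])
  have ej: "e j \<in> N x" "e j \<noteq> e i" using e ij by auto
  note o = opposite_nbrs[OF e(2)[OF ij(1)] ej]
  have xi: "x \<in> N (e i)" and xj: "e j \<in> N (opposite x (e i) (e j))" using e(2)[OF ij(1)] o nbrs_sym by blast+
  have "opposite (e i) (opposite x (e i) (e j)) x = e j"
    by (rule oppositeI[OF o(1) xi o(5)[symmetric] xj ej])
  then show ?thesis
    unfolding flip_eq[OF F ij(1)] flip_eq[OF F' ij(2)] using ij by (auto simp: fun_eq_iff)
qed

text \<open>
  For the first two labels both orders go around the same square; for all others this is the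
  cube property.
\<close>
lemma flip_commute: "flip i (flip j F) = flip j (flip i F)"
proof (cases "frame F \<and> i \<le> m \<and> j \<le> m \<and> i \<noteq> j")
  case True
  obtain x e where Fe: "F = (x, e)" by fastforce
  have F: "frame (x, e)" and ij: "i \<le> m" "j \<le> m" "i \<noteq> j" using True Fe by auto
  note e = frameD[OF F]
  have "opposite (e j) (opposite x (e j) (e i)) (opposite x (e j) (e k)) = opposite (e i) (opposite x (e i) (e j)) (opposite x (e i) (e k))"
    if "k \<le> m" "k \<noteq> i" "k \<noteq> j" for k
    using cube[of "e i" x "e j" "e k"] e ij that by (simp add: opposite_commute[of x "e j" "e i"])
  then show ?thesis
    unfolding Fe flip_flip_eq[OF F ij] flip_flip_eq[OF F ij(2,1) ij(3)[symmetric]]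
    by (auto simp: fun_eq_iff opposite_commute[of x "e j" "e i"])
next
  case False
  consider "\<not> frame F" | "i = j" | "frame F" "\<not> (i \<le> m \<and> j \<le> m)" using False by blast
  then show ?thesis by cases (auto simp: flip_def)
qed

text \<open>
  Transport across a parallelogram keeps the edge vector, and the edge just traversed is reversed.
\<close>
lemma p_flip:
  assumes F: "frame F" and "i \<le> m" "k \<le> m" "l < m"
  shows "p l (snd (flip i F) k) - p l (fst (flip i F)) = (if k = i then - 1 else 1) * (p l (snd F k) - p l (fst F))"
proof -
  obtain x e where Fe: "F = (x, e)" by fastforce
  note e = frameD[OF F[unfolded Fe]]
  show ?thesis
    using p_opposite[of "e i" x "e k" l] e assms by (auto simp: Fe flip_eq[OF F[unfolded Fe]])
qed

lemma ex_frame: "\<exists>F. frame F"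
proof -
  obtain x where x: "x \<in> V" using connected_nonempty[OF conn] by blast
  have "card {..m} = card (N x)" using regular[OF x] by simp
  then obtain e where "bij_betw e {..m} (N x)"
    using finite_same_card_bij finite_nbrs by blast
  then have "frame (x, e)" using x by (simp add: frame_def)
  then show ?thesis by blast
qed

definition base_frame where "base_frame = (SOME F. frame F)"

lemma frame_base_frame: "frame base_frame"
  unfolding base_frame_def using ex_frame by (rule someI_ex)

definition multiflip :: "nat set \<Rightarrow> 'a \<times> (nat \<Rightarrow> 'a)" where
  "multiflip S = Finite_Set.fold flip base_frame S"

definition vertex_at :: "nat set \<Rightarrow> 'a" where
  "vertex_at S = fst (multiflip S)"

sublocale flips: comp_fun_commute flip
  by unfold_locales (simp add: fun_eq_iff flip_commute)

lemma multiflip_empty: "multiflip {} = base_frame"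
  by (simp add: multiflip_def)

lemma multiflip_insert: "finite S \<Longrightarrow> i \<notin> S \<Longrightarrow> multiflip (insert i S) = flip i (multiflip S)"
  by (simp add: multiflip_def)

lemma multiflip_toggle:
  assumes "finite S"
  shows "multiflip (toggle i S) = flip i (multiflip S)"
proof (cases "i \<in> S")
  case True
  then have "multiflip S = flip i (multiflip (S - {i}))"
    using multiflip_insert[of "S - {i}" i] assms by (simp add: insert_absorb)
  then show ?thesis using True by (simp add: toggle_def flip_flip)
qed (simp add: toggle_def multiflip_insert assms)

lemma frame_multiflip: "finite S \<Longrightarrow> frame (multiflip S)"
  by (induction S rule: finite_induct) (simp_all add: multiflip_empty multiflip_insert frame_base_frame frame_flip)

lemma vertex_at_toggle:
  assumes "finite S" "i \<le> m"
  shows "vertex_at (toggle i S) = snd (multiflip S) i"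
  using assms by (simp add: vertex_at_def multiflip_toggle flip_def frame_multiflip)

lemma nbrs_vertex_at:
  assumes "finite S"
  shows "bij_betw (\<lambda>i. vertex_at (toggle i S)) {..m} (N (vertex_at S))"
proof -
  have "bij_betw (snd (multiflip S)) {..m} (N (vertex_at S))"
    using frame_multiflip[OF assms] by (simp add: frame_def vertex_at_def)
  then show ?thesis
    using bij_betw_cong[of "{..m}" "\<lambda>i. vertex_at (toggle i S)" "snd (multiflip S)"]
      vertex_at_toggle[OF assms] by auto
qed

lemma p_multiflip:
  assumes "finite S" "S \<subseteq> {..m}" "k \<le> m" "l < m"
  shows "p l (snd (multiflip S) k) - p l (fst (multiflip S))
     = (if k \<in> S then - 1 else 1) * (p l (snd base_frame k) - p l (fst base_frame))"
  using assms
  by (induction S rule: finite_induct) (auto simp: multiflip_empty multiflip_insert p_flip frame_multiflip)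

lemma p_vertex_at:
  assumes "finite S" "S \<subseteq> {..m}" "l < m"
  shows "p l (vertex_at S) = p l (fst base_frame) + (\<Sum>k\<in>S. p l (snd base_frame k) - p l (fst base_frame))"
  using assms
proof (induction S rule: finite_induct)
  case (insert i S)
  have "vertex_at (insert i S) = snd (multiflip S) i"
    using vertex_at_toggle[of S i] insert by (simp add: toggle_def)
  then have "p l (vertex_at (insert i S)) = p l (vertex_at S) + (p l (snd base_frame i) - p l (fst base_frame))"
    using p_multiflip[of S i l] insert by (simp add: vertex_at_def)
  then show ?case using insert by simp
qed (simp add: vertex_at_def multiflip_empty)

text \<open>
  The image contains all neighbours of each of its members.
\<close>
lemma vertex_at_surj: "vertex_at ` Pow {..m} = V"
proof
  have "vertex_at S \<in> V" if "S \<subseteq> {..m}" for S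
    using frame_multiflip[of S] that finite_subset by (auto simp: vertex_at_def frame_def)
  then show "vertex_at ` Pow {..m} \<subseteq> V" by auto
  show "V \<subseteq> vertex_at ` Pow {..m}"
  proof
    fix y assume y: "y \<in> V"
    have start: "vertex_at {} \<in> V" using \<open>vertex_at ` Pow {..m} \<subseteq> V\<close> by auto
    show "y \<in> vertex_at ` Pow {..m}"
    proof (rule connected_induct[OF conn start _ y])
      fix u v assume "v \<in> N u" "u \<in> vertex_at ` Pow {..m}"
      then obtain S where S: "S \<subseteq> {..m}" "u = vertex_at S" by blast
      then have "v \<in> (\<lambda>i. vertex_at (toggle i S)) ` {..m}"
        using nbrs_vertex_at[of S] \<open>v \<in> N u\<close> finite_subset by (auto simp: bij_betw_def)
      moreover have "toggle i S \<subseteq> {..m}" if "i \<le> m" for i using S that by (auto simp: toggle_def)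
      ultimately show "v \<in> vertex_at ` Pow {..m}" by blast
    qed blast
  qed
qed

text \<open>
  Both sets of labels lead from the base vertex to points with the same image under \<open>p\<close>, so the
  difference of their indicator functions is a relation among the edge vectors at the base vertex.
\<close>
lemma vertex_at_eq_relation:
  assumes S: "S \<subseteq> {..m}" and T: "T \<subseteq> {..m}" and eq: "vertex_at S = vertex_at T"
  obtains \<kappa> where "\<And>k. k \<le> m \<Longrightarrow> of_bool (k \<in> S) - of_bool (k \<in> T) = \<kappa> * n (fst base_frame) (snd base_frame k)"
proof -
  obtain x e where Fe: "base_frame = (x, e)" by fastforce
  have bij: "bij_betw e {..m} (N x)" and x: "x \<in> V" using frame_base_frame by (simp_all add: frame_def Fe)
  define c where "c u = of_bool (inv_into {..m} e u \<in> S) - (of_bool (inv_into {..m} e u \<in> T) :: real)" for u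
  have c: "c (e k) = of_bool (k \<in> S) - of_bool (k \<in> T)" if "k \<le> m" for k
    using bij that by (simp add: c_def bij_betw_def inv_into_f_f)
  have "(\<Sum>u\<in>N x. c u * (p l u - p l x)) = 0" if l: "l < m" for l
  proof -
    let ?v = "\<lambda>k. p l (e k) - p l x"
    have ind: "(\<Sum>k\<le>m. of_bool (k \<in> A) * ?v k) = (\<Sum>k\<in>A. ?v k)" if "A \<subseteq> {..m}" for A
    proof -
      have "(\<Sum>k\<le>m. of_bool (k \<in> A) * ?v k) = (\<Sum>k\<le>m. if k \<in> A then ?v k else 0)" by (intro sum.cong) auto
      then show ?thesis using that by (simp add: sum.If_cases Int_absorb1)
    qed
    have "(\<Sum>u\<in>N x. c u * (p l u - p l x)) = (\<Sum>k\<le>m. c (e k) * ?v k)"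
      by (rule sum.reindex_bij_betw[OF bij, symmetric])
    also have "\<dots> = (\<Sum>k\<le>m. of_bool (k \<in> S) * ?v k - of_bool (k \<in> T) * ?v k)"
      by (intro sum.cong) (auto simp: c algebra_simps)
    also have "\<dots> = (\<Sum>k\<in>S. ?v k) - (\<Sum>k\<in>T. ?v k)" unfolding sum_subtractf ind[OF S] ind[OF T] ..
    also have "\<dots> = 0"
      using p_vertex_at[of S l] p_vertex_at[of T l] S T l eq finite_subset[of _ "{..m}"] by (simp add: Fe)
    finally show ?thesis .
  qed
  then obtain \<kappa> where "\<And>u. u \<in> N x \<Longrightarrow> c u = \<kappa> * n x u" using relation_normal[OF x] by blast
  then show ?thesis using that[of \<kappa>] c bij by (simp add: Fe) (metis atMost_iff bij_betw_apply)
qed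

text \<open>
  Let \<open>S \<noteq> T\<close> lead to the same vertex, and let \<open>i\<close> belong to just one of them.  The difference
  \<open>c\<close> of the indicators is a nonzero multiple of the normal vector.  The step with label \<open>i\<close> from \<open>S\<close> is
  also a step from \<open>T\<close>, with some label \<open>j\<close>, and the new difference \<open>c'\<close> is again a multiple of the normal vector.
  If \<open>j = i\<close>, then \<open>c'\<close> and \<open>c\<close> differ only in the sign at \<open>i\<close>, so \<open>c\<close> is supported at \<open>i\<close> and the
  vertex is adjacent to itself.  If \<open>j \<noteq> i\<close>, then \<open>c'\<close> vanishes at \<open>i\<close>, hence everywhere, and
  \<open>S\<close> and \<open>T\<close> are reached from one set by the different labels \<open>i\<close> and \<open>j\<close>, although a frame is injective.
\<close>
lemma vertex_at_inj: "inj_on vertex_at (Pow {..m})"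
proof (rule inj_onI, rule ccontr)
  fix S T assume "S \<in> Pow {..m}" "T \<in> Pow {..m}" and eq: "vertex_at S = vertex_at T" and ne: "S \<noteq> T"
  then have S: "S \<subseteq> {..m}" "finite S" and T: "T \<subseteq> {..m}" "finite T" using finite_subset by auto
  obtain i where i: "(i \<in> S) = (i \<notin> T)" using ne by blast
  then have im: "i \<le> m" using S T by auto
  define c where "c k = of_bool (k \<in> S) - (of_bool (k \<in> T) :: real)" for k
  obtain \<kappa> where k: "\<And>k. k \<le> m \<Longrightarrow> c k = \<kappa> * n (fst base_frame) (snd base_frame k)"
    using vertex_at_eq_relation[OF S(1) T(1) eq] unfolding c_def by blast
  have ci: "c i \<noteq> 0" using i by (auto simp: c_def)
  then have "\<kappa> \<noteq> 0" using k[OF im] by auto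
  have "vertex_at (toggle i S) \<in> N (vertex_at T)"
    using bij_betw_apply[OF nbrs_vertex_at[OF S(2)], of i] im eq by simp
  then obtain j where j: "j \<le> m" "vertex_at (toggle i S) = vertex_at (toggle j T)"
    unfolding bij_betw_imp_surj_on[OF nbrs_vertex_at[OF T(2)], symmetric] by auto
  define c' where "c' k = of_bool (k \<in> toggle i S) - (of_bool (k \<in> toggle j T) :: real)" for k
  have sub: "toggle i S \<subseteq> {..m}" "toggle j T \<subseteq> {..m}" using S T im j(1) by (auto simp: toggle_def)
  obtain \<kappa>2 where k': "\<And>k. k \<le> m \<Longrightarrow> c' k = \<kappa>2 * n (fst base_frame) (snd base_frame k)"
    using vertex_at_eq_relation[OF sub j(2)] unfolding c'_def by blast
  have proportional: "\<kappa> * c' k = \<kappa>2 * c k" if "k \<le> m" for k using k[OF that] k'[OF that] by simp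
  show False
  proof (cases "j = i")
    case True
    have "c' i = - c i" using True by (auto simp: c_def c'_def in_toggle_iff)
    then have "\<kappa>2 * c i = (- \<kappa>) * c i" using proportional[OF im] by simp
    then have "\<kappa>2 = - \<kappa>" by (rule iffD1[OF mult_right_cancel[OF ci]])
    have "(k \<in> S) = (k \<in> T)" if "k \<le> m" "k \<noteq> i" for k
    proof -
      have "c' k = c k" using True that by (simp add: c_def c'_def in_toggle_iff)
      then have "c k = 0" using proportional[OF that(1)] \<open>\<kappa>2 = - \<kappa>\<close> \<open>\<kappa> \<noteq> 0\<close> by simp
      then show ?thesis by (auto simp: c_def of_bool_def split: if_splits)
    qed
    then have "k \<in> T \<longleftrightarrow> k \<in> toggle i S" for k
      using i S(1) T(1) by (cases "k = i"; cases "k \<le> m") (auto simp: in_toggle_iff)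
    then have "T = toggle i S" by blast
    then have "vertex_at T \<in> N (vertex_at S)"
      using bij_betw_apply[OF nbrs_vertex_at[OF S(2)], of i] im by simp
    then show False using eq nbrs_irrefl by simp
  next
    case False
    have "c' i = 0" using i False by (auto simp: c'_def in_toggle_iff)
    then have "\<kappa>2 = 0" using proportional[OF im] ci by simp
    then have zero: "c' k = 0" if "k \<le> m" for k using k'[OF that] by simp
    have "k \<in> toggle i S \<longleftrightarrow> k \<in> toggle j T" for k
    proof (cases "k \<le> m")
      case True
      then show ?thesis using zero[OF True] by (auto simp: c'_def of_bool_def split: if_splits)
    next
      case False
      then show ?thesis using sub by auto
    qed
    then have eq': "toggle i S = toggle j T" by blast
    have inj: "inj_on (\<lambda>k. vertex_at (toggle k (toggle i S))) {..m}"
      using nbrs_vertex_at[of "toggle i S"] S(2) by (simp add: bij_betw_def)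
    have "vertex_at (toggle i (toggle i S)) = vertex_at (toggle j (toggle i S))"
      unfolding eq'[THEN arg_cong[of _ _ "toggle j"]] by (simp add: eq)
    then have "i = j" by (rule inj_onD[OF inj]) (simp_all add: im j(1))
    then show False using False by simp
  qed
qed

theorem isometric_eigenmap_hypercube: "digraph_iso (with_proj G) (with_proj (hypercube (max_degree G)))"
proof (rule hypercube_digraph_isoI)
  show "pair_graph G" by (rule pair_graph)
  have D: "{..<max_degree G} = {..m}" using max_deg by auto
  show "bij_betw vertex_at (Pow {..<max_degree G}) (pverts G)"
    unfolding D bij_betw_def using vertex_at_inj vertex_at_surj by blast
  fix S assume "S \<subseteq> {..<max_degree G}"
  then have "finite S" using finite_subset by blast
  then show "nbrs G (vertex_at S) = (\<lambda>i. vertex_at (toggle i S)) ` {..<max_degree G}"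
    unfolding D using nbrs_vertex_at[of S] by (simp add: bij_betw_def)
qed

end

section \<open>Rigidity of the hypercube\<close>

text \<open>
  An orthonormal family at one vertex is orthonormal at all, and \<open>projection_codim_le_one\<close> supplies the
  normal vector at each vertex.
\<close>
lemma (in curvature_two_graph) hypercube_if_multiplicity:
  assumes Delta: "max_degree G = Suc m" and mult: "m \<le> laplacian_multiplicity G 2"
  shows "digraph_iso (with_proj G) (with_proj (hypercube (max_degree G)))"
proof -
  obtain x0 where x0: "x0 \<in> pverts G" using connected_nonempty[OF conn] by blast
  obtain p where E: "\<And>i. i < m \<Longrightarrow> p i \<in> E2"
    and on: "\<And>i j. i < m \<Longrightarrow> j < m \<Longrightarrow> 2 * BE_Gamma G (p i) (p j) x0 = (if i = j then 1 else 0)"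
    using E2_orthonormal_family[OF x0 mult] by blast
  define Q where "Q x n \<longleftrightarrow>
      (\<forall>u\<in>nbrs G x. \<forall>w\<in>nbrs G x.
         (\<Sum>i<m. (p i u - p i x) * (p i w - p i x)) = (if u = w then 1 else 0) - n u * n w)
      \<and> (\<Sum>u\<in>nbrs G x. (n u)\<^sup>2) = real (card (nbrs G x)) - real m" for x n
  have "\<forall>x\<in>pverts G. \<exists>n. Q x n"
  proof
    fix x assume x: "x \<in> pverts G"
    show "\<exists>n. Q x n"
    proof (rule projection_codim_le_one[of "nbrs G x" m "\<lambda>i u. p i u - p i x"])
      show "(\<Sum>u\<in>nbrs G x. (p i u - p i x) * (p j u - p j x)) = (if i = j then 1 else 0)"
        if "i < m" "j < m" for i j
        using on[OF that] E2_Gamma_const[OF E[OF that(1)] E[OF that(2)] x x0]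
        by (simp add: BE_Gamma_nbrs)
      show "card (nbrs G x) \<le> Suc m" using card_nbrs_le_max_degree[OF x] Delta by simp
      show "\<exists>n. Q x n"
        if "\<And>u w. u \<in> nbrs G x \<Longrightarrow> w \<in> nbrs G x \<Longrightarrow>
              (\<Sum>i<m. (p i u - p i x) * (p i w - p i x)) = (if u = w then 1 else 0) - n u * n w"
          and "(\<Sum>u\<in>nbrs G x. (n u)\<^sup>2) = real (card (nbrs G x)) - real m" for n
        unfolding Q_def by (intro exI[of _ n] conjI ballI that)
    qed (rule finite_nbrs)
  qed
  from bchoice[OF this] obtain n where n: "\<forall>x\<in>pverts G. Q x (n x)" ..
  interpret isometric_eigenmap G m p n
  proof
    show "Digraph_Component.connected (with_proj G)" by (rule conn)
    show "max_degree G = Suc m" by (rule Delta)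
    show "(\<Sum>i<m. (p i u - p i x) * (p i w - p i x)) = (if u = w then 1 else 0) - n x u * n x w"
      if "x \<in> pverts G" "u \<in> nbrs G x" "w \<in> nbrs G x" for x u w
      using bspec[OF n that(1)] that(2,3) unfolding Q_def by blast
    show "(\<Sum>u\<in>nbrs G x. (n x u)\<^sup>2) = real (card (nbrs G x)) - real m" if "x \<in> pverts G" for x
      using bspec[OF n that] unfolding Q_def by blast
  qed (rule E2_distance_two[OF E] E2_edge[OF E]; assumption)+
  show ?thesis by (rule isometric_eigenmap_hypercube)
qed

theorem theorem7p6:
  fixes G :: "'a pair_pre_digraph"
  assumes "pair_graph G"
    and "Digraph_Component.connected (with_proj G)"
    and "CD_infinity 2 G"
    and "laplacian_eigenvalue G (max_degree G - 1) = 2"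
  shows "digraph_iso (with_proj G) (with_proj (hypercube (max_degree G)))"
proof -
  interpret curvature_two_graph G
    using assms by (simp add: curvature_two_graph_def curvature_two_graph_axioms_def)
  have "max_degree G = Suc (max_degree G - 1)"
    using eigenvalue_2_multiplicity(1)[OF assms(4)] by simp
  then show ?thesis
    using eigenvalue_2_multiplicity(2)[OF assms(4)] by (rule hypercube_if_multiplicity)
qed

end
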